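(* Suppose that $\theta<\kappa$ are infinite regular cardinals, and $\square(\kappa)$ holds. Then there exist two maps $c:[\kappa]^2\rightarrow\kappa\times\kappa$ and $e:[\kappa]^2\rightarrow\theta$ such that: \begin{itemize} \item $e$ is subadditive; \item for every $A\in[\kappa]^\kappa$, there exists a club $D\subseteq\kappa$ such that for every $\delta\in D$, for every $\beta\in\kappa\setminus\delta$, for every $(\xi_0,\xi_1)\in\delta\times\delta$, for every $i<\theta$, there are cofinally many $\alpha<\delta$ such that $\alpha\in A$, $c(\alpha,\beta)=(\xi_0,\xi_1)$ and $e(\alpha,\beta)>i$. \end{itemize}
   Context: The ambient theory is ZFC. Cardinals are von Neumann ordinals. $[\kappa]^\kappa$ is the set of subsets of $\kappa$ of cardinality $\kappa$, and $[\kappa]^2$ is the set of two-element subsets of $\kappa$. For a map $f$ on $[\kappa]^2$ and $\alpha<\beta<\kappa$, $f(\alpha,\beta)$ denotes $f(\{\alpha,\beta\})$. A club in $\kappa$ is a closed unbounded subset of $\kappa$. A coloring $e:[\kappa]^2\rightarrow\theta$ is subadditive if for all $\alpha<\beta<\gamma<\kappa$: (1) $e(\alpha,\gamma)\le\max\{e(\alpha,\beta),e(\beta,\gamma)\}$, and (2) $e(\alpha,\beta)\le\max\{e(\alpha,\gamma),e(\beta,\gamma)\}$. For a set of ordinals $C$, $\mathrm{acc}(C)=\{\alpha\in C\mid \sup(C\cap\alpha)=\alpha>0\}$. For a regular uncountable cardinal $\kappa$, $\square(\kappa)$ is the standard principle asserting the existence of a sequence $\langle C_\alpha\mid\alpha<\kappa,\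 \alpha\text{ a nonzero limit ordinal}\rangle$ such that: each $C_\alpha$ is a closed unbounded subset of $\alpha$; for every $\alpha$ and every $\beta\in\mathrm{acc}(C_\alpha)$, $C_\beta=C_\alpha\cap\beta$; and there is no closed unbounded $C\subseteq\kappa$ such that $C\cap\alpha=C_\alpha$ for every $\alpha\in\mathrm{acc}(C)$. *)

theory Defs
  imports Main
begin

unbundle cardinal_syntax

text \<open>
  A cardinal \<open>\<kappa>\<close> is represented by a type \<open>'k\<close> of class \<open>wellorder\<close> whose order relation is a
  cardinal order; the elements of \<open>'k\<close> are then the ordinals below \<open>\<kappa>\<close>. An ordinal \<open>\<alpha>\<close>, viewed as
  a set, is \<open>{..<\<alpha>}\<close>, and \<open>\<kappa>\<close> as a set is \<open>UNIV\<close>. A map on \<open>[\<kappa>]\<^sup>2\<close> is a function on sets whose values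
  at sets other than two-element sets are ignored.
\<close>

definition order_of :: "'k::wellorder itself \<Rightarrow> 'k rel" where
  "order_of _ = {(x, y). x \<le> y}"

definition infinite_regular_cardinal :: "'a rel \<Rightarrow> bool" where
  "infinite_regular_cardinal r \<longleftrightarrow> Card_order r \<and> infinite (Field r) \<and> regularCard r"

text \<open>
  The supremum of a set of ordinals, with \<open>osup {} = 0\<close>. It is only meaningful for sets bounded
  in \<open>'k\<close>, and is only applied to such sets below.
\<close>

definition osup :: "'k::wellorder set \<Rightarrow> 'k" where
  "osup X = (LEAST b. \<forall>x\<in>X. x \<le> b)"

definition nonzero :: "'k::wellorder \<Rightarrow> bool" where
  "nonzero \<alpha> \<longleftrightarrow> (\<exists>\<beta>. \<beta> < \<alpha>)"

definition nonzero_limit :: "'k::wellorder \<Rightarrow> bool" where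
  "nonzero_limit \<alpha> \<longleftrightarrow> nonzero \<alpha> \<and> (\<forall>\<beta><\<alpha>. \<exists>\<gamma>. \<beta> < \<gamma> \<and> \<gamma> < \<alpha>)"

definition acc_points :: "'k::wellorder set \<Rightarrow> 'k set" where
  "acc_points C = {\<alpha> \<in> C. osup (C \<inter> {..<\<alpha>}) = \<alpha> \<and> nonzero \<alpha>}"

text \<open>In the next three definitions \<open>X\<close> is an ordinal viewed as a set: \<open>{..<\<alpha>}\<close> or \<open>UNIV\<close>.\<close>

definition cofinal_in :: "'k::wellorder set \<Rightarrow> 'k set \<Rightarrow> bool" where
  "cofinal_in X C \<longleftrightarrow> C \<subseteq> X \<and> (\<forall>\<gamma>\<in>X. \<exists>x\<in>C. \<gamma> \<le> x)"

definition closed_in :: "'k::wellorder set \<Rightarrow> 'k set \<Rightarrow> bool" where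
  "closed_in X C \<longleftrightarrow> C \<subseteq> X \<and> (\<forall>\<beta>\<in>X. nonzero \<beta> \<and> osup (C \<inter> {..<\<beta>}) = \<beta> \<longrightarrow> \<beta> \<in> C)"

definition club_in :: "'k::wellorder set \<Rightarrow> 'k set \<Rightarrow> bool" where
  "club_in X C \<longleftrightarrow> closed_in X C \<and> cofinal_in X C"

text \<open>The values of \<open>C\<close> at ordinals that are not nonzero limits play no role.\<close>

definition square_sequence :: "('k::wellorder \<Rightarrow> 'k set) \<Rightarrow> bool" where
  "square_sequence C \<longleftrightarrow>
     (\<forall>\<alpha>. nonzero_limit \<alpha> \<longrightarrow> club_in {..<\<alpha>} (C \<alpha>)) \<and>
     (\<forall>\<alpha>. nonzero_limit \<alpha> \<longrightarrow> (\<forall>\<beta>\<in>acc_points (C \<alpha>). C \<beta> = C \<alpha> \<inter> {..<\<beta>})) \<and>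
     \<not> (\<exists>E. club_in UNIV E \<and> (\<forall>\<alpha>\<in>acc_points E. E \<inter> {..<\<alpha>} = C \<alpha>))"

definition square_principle :: "'k::wellorder itself \<Rightarrow> bool" where
  "square_principle _ \<longleftrightarrow> (\<exists>C :: 'k \<Rightarrow> 'k set. square_sequence C)"

definition subadditive :: "('k::wellorder set \<Rightarrow> 't::wellorder) \<Rightarrow> bool" where
  "subadditive e \<longleftrightarrow> (\<forall>\<alpha> \<beta> \<gamma>. \<alpha> < \<beta> \<and> \<beta> < \<gamma> \<longrightarrow>
     e {\<alpha>, \<gamma>} \<le> max (e {\<alpha>, \<beta>}) (e {\<beta>, \<gamma>}) \<and>
     e {\<alpha>, \<beta>} \<le> max (e {\<alpha>, \<gamma>}) (e {\<beta>, \<gamma>}))"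

end

theory Submission
  imports Defs "HOL-Library.Countable"
begin

text \<open>
  A square sequence is thinned to a coherent system \<open>C\<close> for which \<open>min (C \<delta>)\<close> takes unboundedly many
  values stationarily often; composing with surjections gives labels \<open>h\<close> with any range of
  size at most \<open>\<kappa>\<close> which are constant along \<open>acc (C \<beta>) \<union> {\<beta>}\<close> and have stationary fibres. From a label with values in
  \<open>\<theta>\<close> one builds by recursion on \<open>\<beta>\<close> a subadditive \<open>e(\<alpha>, \<beta>)\<close> with \<open>h \<beta> \<le> e(\<alpha>, \<beta>)\<close> whose sets
  \<open>{\<alpha> < \<beta>. e(\<alpha>, \<beta>) \<le> i}\<close> are closed; the lower bound makes \<open>e\<close> unbounded on every unbounded set.

  The first colouring is \<open>c(\<alpha>, \<beta>) = h(\<beta>\<^sub>k)\<close>, where \<open>h\<close> is a label with values in \<open>\<kappa> \<times> \<kappa>\<close>,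
  \<open>\<beta> = \<beta>\<^sub>0 > \<beta>\<^sub>1 > \<dots>\<close> is the walk from \<open>\<beta>\<close> to \<open>\<alpha>\<close>, and \<open>k = d(\<alpha>, \<beta>)\<close> for a map
  \<open>d : [\<kappa>]\<^sup>2 \<rightarrow> \<omega>\<close> which is onto on every rectangle of unbounded sets. Fodor's lemma fixes the number of steps
  after which the walks pass stationarily many \<open>\<delta>\<close> with \<open>h \<delta> = \<xi>\<close>, and \<open>d\<close> then guesses that number.
  To obtain \<open>d\<close>, use \<open>e\<close> with \<open>\<theta> = \<omega>\<close> and let \<open>M(\<alpha>, \<beta>)\<close> be the maximal length of a chain
  \<open>x\<^sub>1 < x\<^sub>2 < \<dots>\<close> in the lower trace of the walk from \<open>\<beta>\<close> to \<open>\<alpha>\<close> such that \<open>e(x\<^sub>i\<^sub>+\<^sub>1, \<beta>)\<close> exceeds both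
  \<open>e(x\<^sub>i, \<alpha>)\<close> and \<open>e(x\<^sub>i, \<beta>)\<close>. Given a rectangle and \<open>n\<close>, one finds \<open>\<alpha>\<close> and \<open>\<beta>\<^sup>0, \<dots>, \<beta>\<^sup>n\<close>
  in it and \<open>l\<close> with \<open>M(\<alpha>, \<beta>\<^sup>k) \<in> {l + k, l + k + 1}\<close>: the traces of the \<open>\<beta>\<^sup>k\<close> grow by blocks on which
  \<open>\<alpha>\<close> has the larger values, and they share their remaining parts. Finally \<open>d\<close> is the ruler function
  of \<open>\<lfloor>M / 2\<rfloor>\<close>.
\<close>

subsection \<open>Club and stationary subsets of a regular uncountable cardinal\<close>

definition limit_point :: "'k::wellorder set \<Rightarrow> 'k \<Rightarrow> bool" where
  "limit_point X d \<longleftrightarrow> (\<exists>y. y < d) \<and> (\<forall>g<d. \<exists>x\<in>X. g < x \<and> x < d)"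

definition club :: "'k::wellorder set \<Rightarrow> bool" where
  "club E \<longleftrightarrow> (\<forall>d. limit_point E d \<longrightarrow> d \<in> E) \<and> (\<forall>g. \<exists>x\<in>E. g < x)"

definition stationary :: "'k::wellorder set \<Rightarrow> bool" where
  "stationary S \<longleftrightarrow> (\<forall>E. club E \<longrightarrow> (\<exists>x\<in>S. x \<in> E))"

definition unbounded :: "'k::wellorder set \<Rightarrow> bool" where
  "unbounded X \<longleftrightarrow> (\<forall>g. \<exists>x\<in>X. g < x)"

lemma limit_point_mono: "limit_point X d \<Longrightarrow> (\<And>x. x \<in> X \<Longrightarrow> x < d \<Longrightarrow> g < x \<Longrightarrow> x \<in> Y) \<Longrightarrow> g < d \<Longrightarrow> limit_point Y d"
  unfolding limit_point_def
proof (intro conjI allI impI; (elim conjE)?)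
  fix a assume hyp: "\<forall>g<d. \<exists>x\<in>X. g < x \<and> x < d" "\<And>x. x \<in> X \<Longrightarrow> x < d \<Longrightarrow> g < x \<Longrightarrow> x \<in> Y" "g < d" "a < d"
  then have "max a g < d" by simp
  with hyp(1) obtain x where "x \<in> X" "max a g < x" "x < d" by blast
  with hyp(2) show "\<exists>x\<in>Y. a < x \<and> x < d" by auto
qed auto

lemma limit_point_subset: "limit_point X d \<Longrightarrow> X \<inter> {..<d} \<subseteq> Y \<Longrightarrow> limit_point Y d"
  unfolding limit_point_def by blast

lemma limit_point_Int: "limit_point (X \<inter> {..<b}) d \<longleftrightarrow> limit_point X d" if "d \<le> b"
  using that unfolding limit_point_def by (metis (no_types, lifting) IntE IntI lessThan_iff order.strict_trans2)

lemma non_limit_point_bound: "\<not> limit_point X d \<Longrightarrow> y < d \<Longrightarrow> \<exists>g<d. \<forall>x\<in>X. x < d \<longrightarrow> x \<le> g"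
  unfolding limit_point_def by force

text \<open>Turns the supremum conditions in \<open>closed_in\<close> and \<open>acc_points\<close>
  into an order condition, so that the combinatorics can work with limit points only.\<close>

lemma limit_point_osup: "nonzero b \<and> osup (X \<inter> {..<b}) = b \<longleftrightarrow> limit_point X b"
proof
  assume a: "nonzero b \<and> osup (X \<inter> {..<b}) = b"
  show "limit_point X b" unfolding limit_point_def
  proof (intro conjI allI impI)
    show "\<exists>y. y < b" using a by (auto simp: nonzero_def)
    fix g assume "g < b"
    then have "g < (LEAST b'. \<forall>x\<in>X \<inter> {..<b}. x \<le> b')" using a by (simp add: osup_def)
    then have "\<not> (\<forall>x\<in>X \<inter> {..<b}. x \<le> g)" by (rule not_less_Least)
    then show "\<exists>x\<in>X. g < x \<and> x < b" by (auto simp: not_le)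
  qed
next
  assume a: "limit_point X b"
  have "osup (X \<inter> {..<b}) = b" unfolding osup_def
  proof (rule Least_equality)
    show "\<forall>x\<in>X \<inter> {..<b}. x \<le> b" by auto
    fix y assume y: "\<forall>x\<in>X \<inter> {..<b}. x \<le> y"
    show "b \<le> y"
    proof (rule ccontr)
      assume "\<not> b \<le> y" then have "y < b" by simp
      with a obtain x where "x \<in> X" "y < x" "x < b" unfolding limit_point_def by blast
      then have "x \<le> y" using y by blast
      with \<open>y < x\<close> show False by simp
    qed
  qed
  with a show "nonzero b \<and> osup (X \<inter> {..<b}) = b" by (auto simp: limit_point_def nonzero_def)
qed

lemma stationary_mono: "stationary S \<Longrightarrow> S \<subseteq> T \<Longrightarrow> stationary T"
  unfolding stationary_def by blast

text \<open>
  Regularity and uncountability of \<open>\<kappa>\<close> enter the combinatorics only through these two properties;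
  the parameter \<open>K\<close> merely fixes the type.
\<close>

locale regular_uncountable =
  fixes K :: "'k::wellorder itself"
  assumes countable_bounded: "\<And>f :: nat \<Rightarrow> 'k. \<exists>b. \<forall>n. f n < b"
    and segment_bounded: "\<And>(f :: 'k \<Rightarrow> 'k) a. \<exists>b. \<forall>x\<le>a. f x < b"
begin

lemma ex_gt: "\<exists>b. (a::'k) < b"
  using countable_bounded[of "\<lambda>_. a"] by auto

lemma nat_sup:
  fixes f :: "nat \<Rightarrow> 'k"
  assumes "\<And>n. f n < f (Suc n)"
  obtains d where "\<And>n. f n < d" "\<And>g. g < d \<Longrightarrow> \<exists>n. g < f n"
proof -
  define d where "d = (LEAST b. \<forall>n. f n < b)"
  have 1: "\<forall>n. f n < d" unfolding d_def by (rule LeastI_ex) (rule countable_bounded)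
  have 2: "\<exists>n. g < f n" if "g < d" for g
  proof -
    have "\<not> (\<forall>n. f n < g)" using not_less_Least[OF that[unfolded d_def]] .
    then obtain n where "g \<le> f n" by (auto simp: not_less)
    with assms[of n] show ?thesis by (meson order.strict_trans1)
  qed
  show ?thesis using that 1 2 by blast
qed

text \<open>Diagonal intersection: unboundedness comes from iterating \<omega> times a map that
  catches all \<open>E g\<close> with \<open>g \<le> x\<close> at once.\<close>

lemma club_diag:
  assumes "\<And>g::'k. club (E g)"
  shows "club {d. \<forall>g<d. d \<in> E g}"
  unfolding club_def
proof (intro conjI allI impI)
  fix d assume lp: "limit_point {d. \<forall>g<d. d \<in> E g} d"
  have "d \<in> E g" if "g < d" for g
  proof -
    have "limit_point (E g) d"
      by (rule limit_point_mono[OF lp _ that]) auto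
    with assms show ?thesis unfolding club_def by blast
  qed
  then show "d \<in> {d. \<forall>g<d. d \<in> E g}" by blast
next
  fix g0 :: 'k
  have "\<exists>b>x. \<forall>g\<le>x. \<exists>y\<in>E g. x < y \<and> y < b" for x
  proof -
    have "\<forall>g. \<exists>y. y \<in> E g \<and> x < y" using assms unfolding club_def by blast
    then obtain y where y: "\<And>g. y g \<in> E g \<and> x < y g" by metis
    obtain b where "\<forall>g\<le>x. y g < b" using segment_bounded by blast
    with y show ?thesis by (intro exI[of _ b]) (meson order.strict_trans order_refl)
  qed
  then obtain N where N: "\<And>x. x < N x" "\<And>x g. g \<le> x \<Longrightarrow> \<exists>y\<in>E g. x < y \<and> y < N x" by metis
  define f where "f n = (N ^^ n) g0" for n
  have fS: "f (Suc n) = N (f n)" for n by (simp add: f_def)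
  then have inc: "f n < f (Suc n)" for n using N by simp
  obtain d where d: "\<And>n. f n < d" "\<And>g. g < d \<Longrightarrow> \<exists>n. g < f n" using nat_sup[of f] inc by blast
  have mono: "f n \<le> f m" if "n \<le> m" for n m
    using lift_Suc_mono_le[of f n m] inc that by (simp add: less_imp_le)
  have "d \<in> E g" if g: "g < d" for g
  proof -
    \<comment> \<open>Once \<open>f n\<close> exceeds \<open>g\<close>, every interval between
      consecutive terms of \<open>f\<close> contains a point of \<open>E g\<close>.\<close>
    have "limit_point (E g) d" unfolding limit_point_def
    proof (intro conjI allI impI)
      show "\<exists>y. y < d" using g by blast
      fix a assume a: "a < d"
      obtain n where n: "max a g < f n" using d(2)[of "max a g"] a g by auto
      obtain y where "y \<in> E g" "f n < y" "y < N (f n)" using N(2)[of g "f n"] n by (auto simp: less_imp_le)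
      moreover have "N (f n) < d" using d(1)[of "Suc n"] by (simp add: fS)
      ultimately show "\<exists>x\<in>E g. a < x \<and> x < d" using n by (meson max_less_iff_conj order.strict_trans)
    qed
    with assms show ?thesis unfolding club_def by blast
  qed
  moreover have "g0 < d" using d(1)[of 0] by (simp add: f_def)
  ultimately show "\<exists>x\<in>{d. \<forall>g<d. d \<in> E g}. g0 < x" by blast
qed

lemma club_greater: "club {x. (a::'k) < x}"
  unfolding club_def
proof (intro conjI allI impI)
  fix d assume "limit_point {x. a < x} d"
  then obtain x where "a < x" "x < d" unfolding limit_point_def by blast
  then show "d \<in> {x. a < x}" by auto
next
  fix g obtain b where "max a g < b" using ex_gt by blast
  then show "\<exists>x\<in>{x. a < x}. g < x" by auto
qed

lemma club_Int:
  assumes "club (E::'k set)" "club F"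
  shows "club (E \<inter> F)"
  unfolding club_def
proof (intro conjI allI impI)
  fix d assume "limit_point (E \<inter> F) d"
  then have "limit_point E d" "limit_point F d" by (auto elim: limit_point_subset)
  with assms show "d \<in> E \<inter> F" unfolding club_def by blast
next
  fix g0 :: 'k
  define z :: 'k where "z = (LEAST x. True)"
  have z: "z \<le> x" for x unfolding z_def by (simp add: Least_le)
  obtain z1 where z1: "z < z1" using ex_gt by blast
  \<comment> \<open>A binary intersection read as a diagonal one: \<open>E\<close> sits at the least
    index and \<open>F\<close> at all others, so a point above \<open>z1\<close> lies in
    both.\<close>
  have "club {d. \<forall>g<d. d \<in> (if g = z then E else F)}"
    by (rule club_diag) (use assms in auto)
  then obtain d where d: "max z1 g0 < d" "\<forall>g<d. d \<in> (if g = z then E else F)"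
    unfolding club_def by blast
  then have "d \<in> E" using z1 by (auto dest: spec[of _ z])
  moreover have "d \<in> F" using d(1) d(2)[rule_format, of z1] z1 by (auto split: if_splits)
  ultimately show "\<exists>x\<in>E \<inter> F. g0 < x" using d by auto
qed

lemma club_closure: "club {d::'k. \<forall>g<d. f g < d}"
  using club_diag[of "\<lambda>g. {x. f g < x}"] club_greater by simp

lemma club_limits: "club {d. limit_point UNIV (d::'k)}"
  unfolding club_def
proof (intro conjI allI impI)
  fix d assume "limit_point {d. limit_point UNIV (d::'k)} d"
  then show "d \<in> {d. limit_point UNIV d}" by (auto intro: limit_point_subset)
next
  fix g0 :: 'k
  obtain s where s: "\<And>g::'k. g < s g" using ex_gt by metis
  obtain d where "g0 < d" "\<forall>g<d. s g < d" using club_closure[of s] unfolding club_def by blast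
  then have "limit_point UNIV d" unfolding limit_point_def using s by blast
  with \<open>g0 < d\<close> show "\<exists>x\<in>{d. limit_point UNIV d}. g0 < x" by blast
qed

lemma stationary_Int_club:
  assumes "stationary (S::'k set)" "club E"
  shows "stationary (S \<inter> E)"
  unfolding stationary_def
proof (intro allI impI)
  fix F :: "'k set" assume "club F"
  then have "club (E \<inter> F)" using club_Int assms by blast
  then obtain x where "x \<in> S" "x \<in> E \<inter> F" using assms unfolding stationary_def by blast
  then show "\<exists>x\<in>S \<inter> E. x \<in> F" by blast
qed

lemma stationary_greater: "stationary (S::'k set) \<Longrightarrow> stationary {d\<in>S. a < d}"
  by (rule stationary_mono[OF stationary_Int_club[OF _ club_greater]]) auto

lemma stationary_unb: "stationary (S::'k set) \<Longrightarrow> unbounded S"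
  unfolding unbounded_def
proof
  fix g assume "stationary S"
  then obtain x where "x \<in> S" "g < x" using club_greater[of g] unfolding stationary_def by blast
  then show "\<exists>x\<in>S. g < x" by blast
qed

lemma stationary_Diff: "stationary (S::'k set) \<Longrightarrow> \<not> stationary P \<Longrightarrow> stationary (S - P)"
proof -
  assume S: "stationary S" and "\<not> stationary P"
  then obtain E where E: "club E" "\<forall>x\<in>P. x \<notin> E" unfolding stationary_def by blast
  have "stationary (S \<inter> E)" using stationary_Int_club S E by blast
  then show ?thesis by (rule stationary_mono) (use E in auto)
qed

section \<open>Fodor's lemma and its variants for countably many values and for finite
  sequences\<close>

lemma fodor:
  assumes "stationary (S::'k set)" "\<And>d. d \<in> S \<Longrightarrow> f d < d"
  shows "\<exists>g. stationary {d\<in>S. f d = g}"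
proof (rule ccontr)
  assume "\<nexists>g. stationary {d\<in>S. f d = g}"
  then have "\<forall>g. \<exists>E. club E \<and> (\<forall>d\<in>S. f d = g \<longrightarrow> d \<notin> E)" unfolding stationary_def by blast
  then obtain E where E: "\<And>g. club (E g)" "\<And>g d. d \<in> S \<Longrightarrow> f d = g \<Longrightarrow> d \<notin> E g" by metis
  obtain d where "d \<in> S" "\<forall>g<d. d \<in> E g" using assms(1) club_diag[of E] E(1) unfolding stationary_def by blast
  with assms(2) E(2) show False by blast
qed

lemma fodor_ex:
  assumes "stationary (S::'k set)" "\<And>d. d \<in> S \<Longrightarrow> \<exists>g<d. P d g"
  shows "\<exists>S' g. stationary S' \<and> S' \<subseteq> S \<and> (\<forall>d\<in>S'. g < d \<and> P d g)"
proof -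
  obtain f where f: "\<And>d. d \<in> S \<Longrightarrow> f d < d \<and> P d (f d)" using assms(2) by metis
  obtain g where "stationary {d\<in>S. f d = g}" using fodor[OF assms(1), of f] f by blast
  with f show ?thesis by (intro exI[of _ "{d\<in>S. f d = g}"] exI[of _ g]) auto
qed

lemma nat_embed: "\<exists>i :: nat \<Rightarrow> 'k. inj i"
proof -
  obtain s where s: "\<And>g::'k. g < s g" using ex_gt by metis
  define f where "f n = (s ^^ n) undefined" for n
  have "f n < f (Suc n)" for n using s by (simp add: f_def)
  then have "strict_mono f" by (simp add: strict_mono_Suc_iff)
  then have "inj f" by (rule strict_mono_imp_inj_on)
  then show ?thesis by blast
qed

text \<open>Coded as ordinals below a fixed bound \<open>b\<close>, the values form a regressive
  function above \<open>b\<close>.\<close>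

lemma fodor_countable:
  fixes f :: "'k \<Rightarrow> 'c::countable"
  assumes "stationary (S::'k set)"
  shows "\<exists>c. stationary {d\<in>S. f d = c}"
proof -
  obtain i :: "nat \<Rightarrow> 'k" where i: "inj i" using nat_embed by blast
  obtain b where b: "\<forall>n. i n < b" using countable_bounded by blast
  have S: "stationary {d\<in>S. b < d}" using stationary_greater assms .
  have "\<exists>g. stationary {d\<in>{d\<in>S. b < d}. i (to_nat (f d)) = g}"
  proof (rule fodor[OF S])
    fix d assume "d \<in> {d \<in> S. b < d}"
    then show "i (to_nat (f d)) < d" using b by (auto intro: order.strict_trans)
  qed
  then obtain g where g: "stationary {d\<in>{d\<in>S. b < d}. i (to_nat (f d)) = g}" ..
  then obtain d0 where d0: "i (to_nat (f d0)) = g" using stationary_unb[OF g] unfolding unbounded_def by blast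
  have "f d = f d0" if "i (to_nat (f d)) = g" for d
    using injD[OF i, of "to_nat (f d)" "to_nat (f d0)"] that d0 by simp
  then have "{d\<in>{d\<in>S. b < d}. i (to_nat (f d)) = g} \<subseteq> {d\<in>S. f d = f d0}" by blast
  with g have "stationary {d\<in>S. f d = f d0}" by (rule stationary_mono)
  then show ?thesis by blast
qed

text \<open>Press down on the head, then on the tail inside the stationary set just found.\<close>

lemma fodor_list_length:
  assumes "stationary (S::'k set)" "\<forall>d\<in>S. \<forall>x\<in>set (f d). x < d" "\<forall>d\<in>S. length (f d) = n"
  shows "\<exists>c. stationary {d\<in>S. f d = c}"
  using assms
proof (induction n arbitrary: S f)
    case 0
    have "S \<subseteq> {d\<in>S. f d = []}"
    proof
      fix d assume "d \<in> S"
      then have "length (f d) = 0" using "0.prems"(3) by blast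
      then show "d \<in> {d\<in>S. f d = []}" using \<open>d \<in> S\<close> by blast
    qed
    with "0.prems"(1) have "stationary {d\<in>S. f d = []}" by (rule stationary_mono)
    then show ?case ..
  next
    case (Suc n)
    have ne: "f d = hd (f d) # tl (f d)" if "d \<in> S" for d
    proof -
      have "length (f d) = Suc n" using Suc.prems(3) that by blast
      then show ?thesis by (cases "f d") simp_all
    qed
    have "\<exists>g. stationary {d\<in>S. hd (f d) = g}"
    proof (rule fodor[OF Suc.prems(1)])
      fix d assume "d \<in> S"
      from ne[OF this] have "hd (f d) \<in> set (f d)" by (metis list.set_intros(1))
      with Suc.prems(2) \<open>d \<in> S\<close> show "hd (f d) < d" by blast
    qed
    then obtain g where g: "stationary {d\<in>S. hd (f d) = g}" ..
    have "\<exists>c. stationary {d\<in>{d\<in>S. hd (f d) = g}. tl (f d) = c}"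
    proof (rule Suc.IH[OF g])
      have "x < d" if "d \<in> S" "x \<in> set (tl (f d))" for d x
      proof -
        have "x \<in> set (f d)" using that(2) ne[OF that(1)] by (metis list.set_intros(2))
        then show ?thesis using Suc.prems(2) that by blast
      qed
      then show "\<forall>d\<in>{d\<in>S. hd (f d) = g}. \<forall>x\<in>set (tl (f d)). x < d" by blast
      show "\<forall>d\<in>{d\<in>S. hd (f d) = g}. length (tl (f d)) = n" using Suc.prems(3) by simp
    qed
    then obtain c where c: "stationary {d\<in>{d\<in>S. hd (f d) = g}. tl (f d) = c}" ..
    have "{d\<in>{d\<in>S. hd (f d) = g}. tl (f d) = c} \<subseteq> {d\<in>S. f d = g # c}"
    proof
      fix d assume "d \<in> {d\<in>{d\<in>S. hd (f d) = g}. tl (f d) = c}"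
      with ne[of d] show "d \<in> {d\<in>S. f d = g # c}" by simp
    qed
    with c have "stationary {d\<in>S. f d = g # c}" by (rule stationary_mono)
    then show ?case by blast
  qed

lemma fodor_list:
  assumes "stationary (S::'k set)" "\<And>d x. d \<in> S \<Longrightarrow> x \<in> set (f d) \<Longrightarrow> x < d"
  shows "\<exists>c. stationary {d\<in>S. f d = c}"
proof -
  obtain n where n: "stationary {d\<in>S. length (f d) = n}" using fodor_countable[OF assms(1), of "\<lambda>d. length (f d)"] ..
  have "\<exists>c. stationary {d\<in>{d\<in>S. length (f d) = n}. f d = c}"
    by (rule fodor_list_length[OF n, of f n]) (use assms(2) in auto)
  then obtain c where "stationary {d\<in>{d\<in>S. length (f d) = n}. f d = c}" ..
  then have "stationary {d\<in>S. f d = c}" by (rule stationary_mono) auto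
  then show ?thesis by blast
qed

text \<open>Otherwise a common bound for the bounds of the countably many fibres would bound
  \<open>X\<close>.\<close>

lemma unbounded_countable:
  fixes f :: "'k \<Rightarrow> 'c::countable"
  assumes "unbounded (X::'k set)"
  shows "\<exists>c. unbounded {x\<in>X. f x = c}"
proof (rule ccontr)
  assume no: "\<nexists>c. unbounded {x\<in>X. f x = c}"
  have "\<exists>g. \<forall>x\<in>X. f x = c \<longrightarrow> x \<le> g" for c
  proof -
    have "\<not> unbounded {x\<in>X. f x = c}" using no by blast
    then obtain g where "\<forall>x\<in>{x\<in>X. f x = c}. \<not> g < x" unfolding unbounded_def by blast
    then show ?thesis by (intro exI[of _ g]) (simp add: not_less)
  qed
  then obtain g where g: "\<And>c x. x \<in> X \<Longrightarrow> f x = c \<Longrightarrow> x \<le> g c" by metis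
  obtain b where b: "\<forall>n. g (from_nat n) < b" using countable_bounded by blast
  obtain x where x: "x \<in> X" "b < x" using assms unfolding unbounded_def by blast
  have "x \<le> g (f x)" using g x(1) by simp
  also have "\<dots> < b" using b[rule_format, of "to_nat (f x)"] by simp
  finally show False using x by simp
qed

end

subsection \<open>Coherent systems of clubs from a square sequence\<close>

text \<open>
  \<open>C b\<close> is defined for every \<open>b\<close>: it is \<open>{g}\<close> at the successor of \<open>g\<close> and empty at \<open>0\<close>.
\<close>

locale coherent_system = regular_uncountable K for K :: "'k::wellorder itself" +
  fixes C :: "'k \<Rightarrow> 'k set"
  assumes C_less: "\<And>b x. x \<in> C b \<Longrightarrow> x < b"
    and C_cof: "\<And>a b. a < b \<Longrightarrow> \<exists>x\<in>C b. a \<le> x"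
    and C_coh: "\<And>b g. limit_point (C b) g \<Longrightarrow> g < b \<Longrightarrow> g \<in> C b \<and> C g = C b \<inter> {..<g}"

text \<open>A walk towards \<open>g\<close> may stop at some \<open>b\<close> having
  \<open>g\<close> as an accumulation point of \<open>C b\<close>; constancy ensures that the label
  read off there is still that of \<open>g\<close>.\<close>

definition coherent_label :: "('k::wellorder \<Rightarrow> 'k set) \<Rightarrow> ('k \<Rightarrow> 'x) \<Rightarrow> bool" where
  "coherent_label C h \<longleftrightarrow> (\<forall>b g. limit_point (C b) g \<and> g < b \<longrightarrow> h g = h b) \<and>
     (\<forall>x. stationary {d. limit_point UNIV d \<and> h d = x})"

lemma limit_point_UNIV_iff: "limit_point UNIV d \<longleftrightarrow> nonzero_limit d"
  unfolding limit_point_def nonzero_limit_def nonzero_def by auto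

lemma closed_in_iff: "closed_in X C \<longleftrightarrow> C \<subseteq> X \<and> (\<forall>b\<in>X. limit_point C b \<longrightarrow> b \<in> C)"
  by (simp add: closed_in_def limit_point_osup)

lemma club_in_UNIV_iff:
  assumes "\<And>a::'k::wellorder. \<exists>b. a < b"
  shows "club_in UNIV (E::'k set) \<longleftrightarrow> club E"
proof -
  have "cofinal_in UNIV E \<longleftrightarrow> (\<forall>g. \<exists>x\<in>E. g < x)"
  proof
    assume c: "cofinal_in UNIV E"
    show "\<forall>g. \<exists>x\<in>E. g < x"
    proof
      fix g :: 'k
      obtain b where "g < b" using assms by blast
      moreover obtain x where "x \<in> E" "b \<le> x" using c unfolding cofinal_in_def by blast
      ultimately show "\<exists>x\<in>E. g < x" by (meson order.strict_trans2)
    qed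
  qed (auto simp: cofinal_in_def intro: less_imp_le)
  then show ?thesis by (auto simp: club_in_def closed_in_iff club_def)
qed

lemma club_in_limit:
  assumes "nonzero_limit a" "club_in {..<a} C"
  shows "limit_point C a" "C \<subseteq> {..<a}" "\<And>b. b < a \<Longrightarrow> limit_point C b \<Longrightarrow> b \<in> C"
proof -
  have cof: "C \<subseteq> {..<a}" "\<forall>g<a. \<exists>x\<in>C. g \<le> x"
    using assms(2) by (auto simp: club_in_def cofinal_in_def)
  show "C \<subseteq> {..<a}" by fact
  show "limit_point C a" unfolding limit_point_def
  proof (intro conjI allI impI)
    show "\<exists>y. y < a" using assms(1) by (simp add: nonzero_limit_def nonzero_def)
    fix g assume "g < a"
    then obtain g' where "g < g'" "g' < a" using assms(1) unfolding nonzero_limit_def by blast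
    moreover then obtain x where "x \<in> C" "g' \<le> x" using cof by blast
    ultimately show "\<exists>x\<in>C. g < x \<and> x < a" using cof(1) by (meson lessThan_iff order.strict_trans2 subsetD)
  qed
  show "b \<in> C" if "b < a" "limit_point C b" for b
    using assms(2) that by (simp add: club_in_def closed_in_iff)
qed

lemma acc_points_iff: "b \<in> acc_points C \<longleftrightarrow> b \<in> C \<and> limit_point C b"
  unfolding acc_points_def using limit_point_osup by blast

context regular_uncountable
begin

text \<open>If this failed for every \<open>\<eta>\<close>, the sets \<open>C d\<close> for \<open>d\<close> in a diagonal intersection would cohere to a thread.\<close>

lemma square_jump:
  assumes sq: "square_sequence (C :: 'k \<Rightarrow> 'k set)"
  shows "\<exists>\<eta>. \<forall>b. stationary {d. limit_point UNIV d \<and> \<eta> < d \<and> (\<forall>x\<in>C d. \<eta> \<le> x \<longrightarrow> b \<le> x)}"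
proof (rule ccontr)
  assume no: "\<not> ?thesis"
  have Cl: "limit_point (C d) d" "C d \<subseteq> {..<d}" "\<And>b. b < d \<Longrightarrow> limit_point (C d) b \<Longrightarrow> b \<in> C d \<and> C b = C d \<inter> {..<b}"
    if "limit_point UNIV d" for d
  proof -
    have nl: "nonzero_limit d" using that limit_point_UNIV_iff by blast
    then have cl: "club_in {..<d} (C d)" using sq by (simp add: square_sequence_def)
    show "limit_point (C d) d" "C d \<subseteq> {..<d}" using club_in_limit[OF nl cl] by auto
    show "b \<in> C d \<and> C b = C d \<inter> {..<b}" if "b < d" "limit_point (C d) b" for b
    proof -
      have "b \<in> C d" using club_in_limit(3)[OF nl cl that] .
      moreover then have "b \<in> acc_points (C d)" using that by (simp add: acc_points_iff)
      ultimately show ?thesis using sq nl by (simp add: square_sequence_def)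
    qed
  qed
  \<comment> \<open>The failure at \<open>\<eta>\<close> supplies a bound \<open>b\<close> and a
    club on whose limit ordinals \<open>d > \<eta>\<close> the set \<open>C d\<close> has a point in
    \<open>[\<eta>, b)\<close>.\<close>
  have "\<exists>b E. club E \<and> (\<forall>d\<in>E. limit_point UNIV d \<and> \<eta> < d \<longrightarrow> (\<exists>x\<in>C d. \<eta> \<le> x \<and> x < b))" for \<eta>
  proof -
    from no obtain b where "\<not> stationary {d. limit_point UNIV d \<and> \<eta> < d \<and> (\<forall>x\<in>C d. \<eta> \<le> x \<longrightarrow> b \<le> x)}" by blast
    then obtain E where "club E" and E: "\<And>d. limit_point UNIV d \<Longrightarrow> \<eta> < d \<Longrightarrow> (\<forall>x\<in>C d. \<eta> \<le> x \<longrightarrow> b \<le> x) \<Longrightarrow> d \<notin> E"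
      unfolding stationary_def by blast
    show ?thesis
    proof (intro exI conjI ballI impI)
      show "club E" by fact
      fix d assume "d \<in> E" "limit_point UNIV d \<and> \<eta> < d"
      then have "\<not> (\<forall>x\<in>C d. \<eta> \<le> x \<longrightarrow> b \<le> x)" using E by blast
      then show "\<exists>x\<in>C d. \<eta> \<le> x \<and> x < b" by (auto simp: not_le)
    qed
  qed
  then obtain b E where E: "\<And>\<eta>. club (E \<eta>)"
    "\<And>\<eta> d. d \<in> E \<eta> \<Longrightarrow> limit_point UNIV d \<Longrightarrow> \<eta> < d \<Longrightarrow> \<exists>x\<in>C d. \<eta> \<le> x \<and> x < b \<eta>" by metis
  define D where "D = {d. \<forall>g<d. d \<in> E g} \<inter> {d. \<forall>g<d. b g < d} \<inter> {d. limit_point UNIV d}"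
  have "club D" unfolding D_def using club_diag[of E] E(1) club_closure[of b] club_limits club_Int by blast
  then have unbD: "\<exists>d\<in>D. g < d" for g unfolding club_def by blast
  have lD: "limit_point UNIV d" if "d \<in> D" for d using that by (simp add: D_def)
  \<comment> \<open>For \<open>g' < d\<close> the set \<open>C d'\<close> has a point in
    \<open>[g', b g')\<close>, and \<open>b g' < d\<close> because \<open>d\<close> is closed under
    \<open>b\<close>.\<close>
  have lp: "limit_point (C d') d" if trace_colour: "d \<in> D" "d' \<in> D" "d < d'" for d d'
    unfolding limit_point_def
  proof (intro conjI allI impI)
    show "\<exists>y. y < d" using lD[OF that(1)] by (auto simp: limit_point_def)
    fix g assume "g < d"
    then obtain g' where g': "g < g'" "g' < d" using lD[OF trace_colour(1)] by (auto simp: limit_point_def)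
    have "d' \<in> E g'" using trace_colour g' by (auto simp: D_def)
    moreover have "g' < d'" using g' trace_colour(3) by simp
    ultimately obtain x where x: "x \<in> C d'" "g' \<le> x" "x < b g'" using E(2)[OF _ lD[OF trace_colour(2)]] by blast
    have "b g' < d" using trace_colour(1) g' by (auto simp: D_def)
    with g' x have "g < x \<and> x < d" by (meson order.strict_trans order.strict_trans2)
    then show "\<exists>x\<in>C d'. g < x \<and> x < d" using x(1) by blast
  qed
  have coh: "C d = C d' \<inter> {..<d}" if "d \<in> D" "d' \<in> D" "d < d'" for d d'
    using Cl(3)[OF lD[OF that(2)] that(3) lp[OF that]] by blast
  \<comment> \<open>Members of \<open>D\<close> carry sets that end-extend each other; their union
    is the forbidden thread.\<close>
  define T where "T = (\<Union>d\<in>D. C d)"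
  have TD: "T \<inter> {..<d} = C d" if d: "d \<in> D" for d
  proof
    show "C d \<subseteq> T \<inter> {..<d}" using d Cl(2)[OF lD[OF d]] by (auto simp: T_def)
    show "T \<inter> {..<d} \<subseteq> C d"
    proof
      fix x assume "x \<in> T \<inter> {..<d}"
      then obtain d' where d': "d' \<in> D" "x \<in> C d'" "x < d" by (auto simp: T_def)
      consider "d < d'" | "d' = d" | "d' < d" by force
      then show "x \<in> C d"
        by cases (use coh[of d d'] coh[of d' d] d d' in auto)
    qed
  qed
  have "club T" unfolding club_def
  proof (intro conjI allI impI)
    fix a assume a: "limit_point T a"
    obtain d where d: "d \<in> D" "a < d" using unbD by blast
    have "limit_point (C d) a" using a TD[OF d(1)] d(2) limit_point_Int[of a d T] by simp
    then show "a \<in> T" using Cl(3)[OF lD] d by (auto simp: T_def)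
  next
    fix g
    obtain d where d: "d \<in> D" "g < d" using unbD by blast
    then obtain x where "x \<in> C d" "g < x" using Cl(1)[OF lD[OF d(1)]] unfolding limit_point_def by blast
    then show "\<exists>x\<in>T. g < x" using d by (auto simp: T_def)
  qed
  moreover have "\<forall>a\<in>acc_points T. T \<inter> {..<a} = C a"
  proof
    fix a assume "a \<in> acc_points T"
    then have a: "limit_point T a" by (simp add: acc_points_iff)
    obtain d where d: "d \<in> D" "a < d" using unbD by blast
    have "limit_point (C d) a" using a TD[OF d(1)] d(2) limit_point_Int[of a d T] by simp
    then have "C a = C d \<inter> {..<a}" using Cl(3)[OF lD] d by blast
    moreover have "{..<d} \<inter> {..<a} = {..<a}" using d(2) by auto
    then have "T \<inter> {..<a} = (T \<inter> {..<d}) \<inter> {..<a}" by (simp only: Int_assoc)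
    ultimately show "T \<inter> {..<a} = C a" unfolding TD[OF d(1)] by (rule trans[OF _ sym, rotated])
  qed
  moreover have "club_in UNIV T" using club_in_UNIV_iff[of T, OF ex_gt] \<open>club T\<close> by simp
  ultimately show False using sq unfolding square_sequence_def by blast
qed

text \<open>\<open>m d\<close> is the least element of \<open>C d\<close>. A nonempty initial
  segment has the same least element, which gives constancy along accumulation points.\<close>

lemma square_coherent_system:
  assumes sq: "square_sequence (C0 :: 'k \<Rightarrow> 'k set)"
  shows "\<exists>(C :: 'k \<Rightarrow> 'k set) (m :: 'k \<Rightarrow> 'k). coherent_system C \<and> (\<forall>b g. limit_point (C b) g \<and> g < b \<longrightarrow> m g = m b) \<and>
    unbounded {z. stationary {d. limit_point UNIV d \<and> m d = (z::'k)}}"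
proof -
  obtain \<eta> where \<eta>: "\<And>b. stationary {d. limit_point UNIV d \<and> \<eta> < d \<and> (\<forall>x\<in>C0 d. \<eta> \<le> x \<longrightarrow> b \<le> x)}"
    using square_jump[OF sq] by blast
  have Cl: "limit_point (C0 d) d" "C0 d \<subseteq> {..<d}" "\<And>b. b < d \<Longrightarrow> limit_point (C0 d) b \<Longrightarrow> b \<in> C0 d \<and> C0 b = C0 d \<inter> {..<b}"
    if "limit_point UNIV d" for d
  proof -
    have nl: "nonzero_limit d" using that limit_point_UNIV_iff by blast
    then have cl: "club_in {..<d} (C0 d)" using sq by (simp add: square_sequence_def)
    show "limit_point (C0 d) d" "C0 d \<subseteq> {..<d}" using club_in_limit[OF nl cl] by auto
    show "b \<in> C0 d \<and> C0 b = C0 d \<inter> {..<b}" if "b < d" "limit_point (C0 d) b" for b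
    proof -
      have "b \<in> C0 d" using club_in_limit(3)[OF nl cl that] .
      moreover then have "b \<in> acc_points (C0 d)" using that by (simp add: acc_points_iff)
      ultimately show ?thesis using sq nl by (simp add: square_sequence_def)
    qed
  qed
  \<comment> \<open>Cutting at \<open>\<eta>\<close> keeps coherence: a limit point of a cut set
    lies above \<open>\<eta>\<close>, so its own set is cut at the same place.\<close>
  define C where "C d = (if limit_point UNIV d then (if \<eta> < d then C0 d \<inter> {\<eta>..} else C0 d)
     else {g. g < d \<and> (\<forall>x<d. x \<le> g)})" for d
  define m where "m d = (LEAST x. x \<in> C d)" for d
  have Cless: "x < b" if "x \<in> C b" for x b
    using that Cl(2) by (auto simp: C_def split: if_splits)
  have lpC: "limit_point (C d) d" if "limit_point UNIV d" for d
  proof (cases "\<eta> < d")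
    case True
    show ?thesis by (rule limit_point_mono[OF Cl(1)[OF that] _ True]) (use that True in \<open>auto simp: C_def\<close>)
  qed (use Cl(1) that in \<open>simp add: C_def\<close>)
  have coh: "g \<in> C b \<and> C g = C b \<inter> {..<g}" if lp: "limit_point (C b) g" and gb: "g < b" for b g
  proof -
    have lg: "limit_point UNIV g" using lp by (auto elim: limit_point_subset)
    have lb: "limit_point UNIV b"
    proof (rule ccontr)
      assume "\<not> limit_point UNIV b"
      then have Cb: "C b = {g. g < b \<and> (\<forall>x<b. x \<le> g)}" by (simp add: C_def)
      obtain x where "x \<in> C b" "x < g" using lp unfolding limit_point_def by blast
      with gb Cb show False by auto
    qed
    show ?thesis
    proof (cases "\<eta> < b")
      case True
      then have Cb: "C b = C0 b \<inter> {\<eta>..}" using lb by (simp add: C_def)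
      have "limit_point (C0 b) g" using lp Cb by (auto elim: limit_point_subset)
      then have g: "g \<in> C0 b" "C0 g = C0 b \<inter> {..<g}" using Cl(3)[OF lb gb] by auto
      obtain x where "x \<in> C b" "x < g" using lp unfolding limit_point_def by blast
      then have "\<eta> < g" using Cb by auto
      then show ?thesis using g lg Cb by (auto simp: C_def)
    next
      case False
      then have Cb: "C b = C0 b" using lb by (simp add: C_def)
      have g: "g \<in> C0 b" "C0 g = C0 b \<inter> {..<g}" using Cl(3)[OF lb gb] lp Cb by auto
      then show ?thesis using False gb lg Cb by (auto simp: C_def)
    qed
  qed
  have cof: "\<exists>x\<in>C b. a \<le> x" if ab: "a < b" for a b
  proof (cases "limit_point UNIV b")
    case True
    then show ?thesis using lpC[OF True] that unfolding limit_point_def by (meson less_imp_le)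
  next
    case False
    then obtain g where "g < b" "\<forall>x\<in>UNIV. x < b \<longrightarrow> x \<le> g" using non_limit_point_bound[OF False ab] by blast
    with False ab show ?thesis by (intro bexI[of _ g]) (auto simp: C_def)
  qed
  have cs: "coherent_system C"
  proof
    show "\<And>b x. x \<in> C b \<Longrightarrow> x < b" by (rule Cless)
    show "\<And>a b. a < b \<Longrightarrow> \<exists>x\<in>C b. a \<le> x" by (rule cof)
    show "\<And>b g. limit_point (C b) g \<Longrightarrow> g < b \<Longrightarrow> g \<in> C b \<and> C g = C b \<inter> {..<g}" by (rule coh)
  qed
  have mm: "m g = m b" if lp: "limit_point (C b) g" and gb: "g < b" for b g
  proof -
    have Cg: "C g = C b \<inter> {..<g}" using coh[OF that] by blast
    obtain x where x: "x \<in> C b" "x < g" using lp unfolding limit_point_def by blast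
    have "m b \<in> C b" "m b \<le> x" unfolding m_def using x(1) by (auto intro: LeastI Least_le)
    then have 1: "m b \<in> C g" using x Cg by auto
    show ?thesis unfolding m_def[of g]
    proof (rule Least_equality)
      show "m b \<in> C g" by fact
      fix y assume "y \<in> C g"
      then show "m b \<le> y" using Cg unfolding m_def by (auto intro: Least_le)
    qed
  qed
  have um: "unbounded {z. stationary {d. limit_point UNIV d \<and> m d = z}}"
    unfolding unbounded_def
  proof
    fix b0 :: 'k
    obtain b where b: "b0 < b" using ex_gt by blast
    let ?S = "{d. limit_point UNIV d \<and> \<eta> < d \<and> (\<forall>x\<in>C0 d. \<eta> \<le> x \<longrightarrow> b \<le> x)}"
    have mC: "m d \<in> C d" if ld: "limit_point UNIV d" for d
    proof -
      obtain x where "x \<in> C d" using lpC[OF ld] unfolding limit_point_def by blast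
      then show ?thesis unfolding m_def by (rule LeastI)
    qed
    \<comment> \<open>\<open>m\<close> is regressive at limits, and on \<open>?S\<close> the set
      \<open>C0 d\<close> has no point in \<open>[\<eta>, b)\<close>; hence the constant value
      \<open>z\<close> is at least \<open>b\<close>.\<close>
    have "\<exists>z. stationary {d\<in>?S. m d = z}"
    proof (rule fodor[OF \<eta>])
      fix d assume "d \<in> ?S"
      then show "m d < d" using Cless[OF mC] by simp
    qed
    then obtain z where z: "stationary {d\<in>?S. m d = z}" ..
    then obtain d where d: "d \<in> ?S" "m d = z" using stationary_unb[OF z] unfolding unbounded_def by blast
    then have "z \<in> C0 d" "\<eta> \<le> z" using mC[of d] by (auto simp: C_def)
    then have "b \<le> z" using d by blast
    moreover have "stationary {d. limit_point UNIV d \<and> m d = z}" using z by (rule stationary_mono) auto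
    ultimately show "\<exists>z\<in>{z. stationary {d. limit_point UNIV d \<and> m d = z}}. b0 < z" using b by auto
  qed
  have "\<forall>b g. limit_point (C b) g \<and> g < b \<longrightarrow> m g = m b" using mm by blast
  with cs um show ?thesis by blast
qed

end

subsection \<open>A subadditive colouring with a prescribed lower bound\<close>

context coherent_system
begin

definition next_step :: "'k \<Rightarrow> 'k \<Rightarrow> 'k" where
  "next_step a b = (LEAST x. x \<in> C b \<and> a \<le> x)"

lemma next_step_props:
  assumes "a < b"
  shows "next_step a b \<in> C b" "a \<le> next_step a b" "next_step a b < b" "\<And>x. x \<in> C b \<Longrightarrow> a \<le> x \<Longrightarrow> next_step a b \<le> x"
proof -
  have ex: "\<exists>x. x \<in> C b \<and> a \<le> x" using C_cof[OF assms] by blast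
  from LeastI_ex[OF ex] show 1: "next_step a b \<in> C b" "a \<le> next_step a b" by (auto simp: next_step_def)
  show "next_step a b < b" using 1 C_less by blast
  show "next_step a b \<le> x" if "x \<in> C b" "a \<le> x" for x
    unfolding next_step_def by (rule Least_le) (use that in blast)
qed

lemma next_step_eq: "x \<in> C b \<Longrightarrow> a \<le> x \<Longrightarrow> (\<And>y. y \<in> C b \<Longrightarrow> a \<le> y \<Longrightarrow> x \<le> y) \<Longrightarrow> next_step a b = x"
  unfolding next_step_def by (rule Least_equality) auto

lemma limit_point_C: "limit_point UNIV d \<Longrightarrow> limit_point (C d) d"
  unfolding limit_point_def
proof (elim conjE, intro conjI allI impI)
  fix g assume "\<forall>g<d. \<exists>x\<in>UNIV. g < x \<and> x < d" "g < d"
  then obtain g' where "g < g'" "g' < d" by blast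
  then show "\<exists>x\<in>C d. g < x \<and> x < d" using C_cof[of g' d] C_less by (meson order.strict_trans2)
qed

end

locale labelled_system = coherent_system K C for K :: "'k::wellorder itself" and C :: "'k \<Rightarrow> 'k set" +
  fixes h :: "'k \<Rightarrow> 't::wellorder"
  assumes h_coh: "\<And>b g. limit_point (C b) g \<Longrightarrow> g < b \<Longrightarrow> h g = h b"
    and h_stationary: "\<And>i. stationary {d. limit_point UNIV d \<and> i < h d}"
begin

definition ebot :: 't where "ebot = (LEAST x. True)"

definition accs :: "'k \<Rightarrow> 'k set" where "accs t = {g. limit_point (C t) g \<and> g < t}"

text \<open>The weak inequality keeps the last accumulation point of \<open>C t\<close> in the set
  when there is one; subadditivity compares values through it.\<close>

definition upper :: "'k \<Rightarrow> 'k \<Rightarrow> 'k set" where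
  "upper a t = {x \<in> C t. (\<forall>g\<in>accs t. g \<le> x) \<and> x \<le> next_step a t}"

text \<open>
  The second alternative occurs only above the last accumulation point of \<open>C t\<close>. There \<open>upper a t\<close>
  is finite, so that \<open>LEAST\<close> is a maximum; including the values on \<open>upper a t\<close> in it makes \<open>e _ t\<close>
  independent, up to that maximum, of the element of \<open>C t\<close> through which \<open>a\<close> is compared with \<open>t\<close>.
\<close>

definition estep :: "('k \<Rightarrow> 'k \<Rightarrow> 't) \<Rightarrow> 'k \<Rightarrow> 'k \<Rightarrow> 't" where
  "estep r t a =
    (if a < t then
       if \<exists>g\<in>accs t. a \<le> g then max (h t) (r (LEAST g. g \<in> accs t \<and> a \<le> g) a)
       else LEAST m. h t \<le> m \<and> r (next_step a t) a \<le> m \<and> (\<forall>y\<in>upper a t. \<forall>z\<in>upper a t. y < z \<longrightarrow> r z y \<le> m)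
     else ebot)"

definition e :: "'k \<Rightarrow> 'k \<Rightarrow> 't" where
  "e a t = wfrec {(x, y). x < y} estep t a"

lemma ebot_le [simp]: "ebot \<le> x"
  unfolding ebot_def by (simp add: Least_le)

lemma max_ebot [simp]: "max x ebot = x" "max ebot x = x"
  by (simp_all add: max_absorb1 max_absorb2)

lemma e_unfold: "e a t = estep (\<lambda>t a. e a t) t a"
proof -
  let ?R = "{(x::'k, y). x < y}"
  let ?r = "cut (wfrec ?R estep) ?R t"
  have cut: "?r x b = e b x" if "x < t" for x b
    using that by (simp add: cut_apply e_def)
  have "e a t = estep ?r t a"
    unfolding e_def using wfrec[OF wf, of estep t] by simp
  also have "\<dots> = estep (\<lambda>t a. e a t) t a"
  proof (cases "a < t")
    case True
    show ?thesis
    proof (cases "\<exists>g\<in>accs t. a \<le> g")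
      case ex: True
      then have "\<exists>g. g \<in> accs t \<and> a \<le> g" by blast
      from LeastI_ex[OF this] have "(LEAST g. g \<in> accs t \<and> a \<le> g) < t" by (simp add: accs_def)
      then show ?thesis using True ex by (simp add: estep_def cut)
    next
      case False
      have 1: "?r (next_step a t) a = e a (next_step a t)" using cut next_step_props(3)[OF True] by blast
      have "?r z y = e y z" if "z \<in> upper a t" for y z
        using that cut C_less by (auto simp: upper_def)
      then have "(\<forall>y\<in>upper a t. \<forall>z\<in>upper a t. y < z \<longrightarrow> ?r z y \<le> m) \<longleftrightarrow>
        (\<forall>y\<in>upper a t. \<forall>z\<in>upper a t. y < z \<longrightarrow> e y z \<le> m)" for m by simp
      then show ?thesis using True False 1 by (simp add: estep_def)
    qed
  qed (simp add: estep_def)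
  finally show ?thesis .
qed

lemma e_ge: "t \<le> a \<Longrightarrow> e a t = ebot"
  by (subst e_unfold) (simp add: estep_def not_less[symmetric])

lemma e_refl [simp]: "e a a = ebot"
  by (simp add: e_ge)

lemma accs_coh: "g \<in> accs t \<Longrightarrow> C g = C t \<inter> {..<g}" "g \<in> accs t \<Longrightarrow> h g = h t"
    "g \<in> accs t \<Longrightarrow> g \<in> C t" "g \<in> accs t \<Longrightarrow> g < t"
  using C_coh h_coh by (auto simp: accs_def)

lemma accs_accs: "g \<in> accs t \<Longrightarrow> accs g = accs t \<inter> {..<g}"
  using accs_coh(1)[of g t] limit_point_Int[of _ g "C t"] accs_coh(4)[of g t] by (auto simp: accs_def intro: less_imp_le)

text \<open>The accumulation points of \<open>C g\<close> are those of \<open>C t\<close> below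
  \<open>g\<close>, so both recursions pass through the same least one above \<open>a\<close>, and
  \<open>h g = h t\<close>.\<close>

lemma e_low:
  assumes g: "g \<in> accs t" and "a \<le> g"
  shows "e a t = max (h t) (e a g)"
proof -
  have ex: "\<exists>g. g \<in> accs t \<and> a \<le> g" using assms by blast
  define g0 where "g0 = (LEAST g. g \<in> accs t \<and> a \<le> g)"
  have g0: "g0 \<in> accs t" "a \<le> g0" using LeastI_ex[OF ex] by (auto simp: g0_def)
  have g0le: "g0 \<le> g'" if "g' \<in> accs t" "a \<le> g'" for g'
    unfolding g0_def by (rule Least_le) (use that in blast)
  have "a < t" using g0 accs_coh(4) by (meson order.strict_trans1)
  then have 1: "e a t = max (h t) (e a g0)"
    using ex by (subst e_unfold) (auto simp: estep_def g0_def)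
  show ?thesis
  proof (cases "g0 = g")
    case False
    then have lt: "g0 < g" using g0le[OF assms] by simp
    have g0g: "g0 \<in> accs g" using accs_accs[OF g] g0 lt by simp
    have "(LEAST g'. g' \<in> accs g \<and> a \<le> g') = g0"
      by (rule Least_equality) (use g0g g0 g0le accs_accs[OF g] in auto)
    moreover have "a < g" using g0 lt by simp
    ultimately have "e a g = max (h g) (e a g0)"
      using g0g g0 by (subst e_unfold) (auto simp: estep_def)
    then show ?thesis using 1 accs_coh(2)[OF g] by (simp add: max.left_commute flip: max.assoc)
  qed (use 1 in simp)
qed

lemma e_acc: "g \<in> accs t \<Longrightarrow> e g t = h t"
  using e_low[of g t g] by simp

lemma finite_upper:
  assumes "a < t"
  shows "finite (upper a t)"
proof (rule ccontr)
  assume inf: "infinite (upper a t)"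
  let ?U = "upper a t"
  have "?U \<subseteq> insert (next_step a t) (?U \<inter> {..<next_step a t})" by (auto simp: upper_def)
  with inf have i: "infinite (?U \<inter> {..<next_step a t})" by (metis finite_insert finite_subset)
  \<comment> \<open>The first ordinal with infinitely many elements of \<open>?U\<close> below it is
    a limit point of \<open>?U\<close>, hence an accumulation point of \<open>C t\<close> above some
    element of \<open>?U\<close>.\<close>
  define d where "d = (LEAST d. infinite (?U \<inter> {..<d}))"
  have d: "infinite (?U \<inter> {..<d})" unfolding d_def by (rule LeastI[of _ "next_step a t"]) (rule i)
  have dn: "d \<le> next_step a t" unfolding d_def by (rule Least_le) (rule i)
  have "limit_point ?U d" unfolding limit_point_def
  proof (intro conjI allI impI)
    show "\<exists>y. y < d" using d by (metis Int_empty_right finite.emptyI lessThan_iff subsetI subset_empty)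
    fix g assume "g < d"
    then have "finite (?U \<inter> {..<g})" unfolding d_def using not_less_Least by blast
    then have "finite (insert g (?U \<inter> {..<g}))" by simp
    then obtain x where x: "x \<in> ?U \<inter> {..<d}" "x \<notin> insert g (?U \<inter> {..<g})"
      using d by (meson finite_subset subsetI)
    then have "g < x" by auto
    then show "\<exists>x\<in>?U. g < x \<and> x < d" using x by blast
  qed
  moreover then have "limit_point (C t) d" by (rule limit_point_subset) (auto simp: upper_def)
  moreover have "d < t" using dn next_step_props(3)[OF assms] by simp
  ultimately have "d \<in> accs t" by (simp add: accs_def)
  moreover obtain x where "x \<in> ?U" "x < d" using \<open>limit_point ?U d\<close> unfolding limit_point_def by blast
  ultimately show False by (auto simp: upper_def)
qed

text \<open>By \<open>finite_upper\<close> the values in question have a common bound, so the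
  \<open>LEAST\<close> satisfies its own predicate and acts as their maximum.\<close>

lemma e_high:
  assumes "a < t" "\<not> (\<exists>g\<in>accs t. a \<le> g)"
  shows "e a t \<le> m \<longleftrightarrow> h t \<le> m \<and> e a (next_step a t) \<le> m \<and> (\<forall>y\<in>upper a t. \<forall>z\<in>upper a t. y < z \<longrightarrow> e y z \<le> m)"
proof -
  let ?P = "\<lambda>m. h t \<le> m \<and> e a (next_step a t) \<le> m \<and> (\<forall>y\<in>upper a t. \<forall>z\<in>upper a t. y < z \<longrightarrow> e y z \<le> m)"
  have eq: "e a t = (LEAST m. ?P m)" using assms by (subst e_unfold) (simp add: estep_def)
  let ?V = "(\<lambda>(y, z). e y z) ` (upper a t \<times> upper a t)"
  have fin: "finite (insert (h t) (insert (e a (next_step a t)) ?V))" using finite_upper[OF assms(1)] by simp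
  have le: "v \<le> Max (insert (h t) (insert (e a (next_step a t)) ?V))"
    if "v \<in> insert (h t) (insert (e a (next_step a t)) ?V)" for v
    using Max_ge[OF fin that] .
  have "?P (Max (insert (h t) (insert (e a (next_step a t)) ?V)))"
  proof (intro conjI ballI impI)
    fix y z assume "y \<in> upper a t" "z \<in> upper a t"
    then show "e y z \<le> Max (insert (h t) (insert (e a (next_step a t)) ?V))" by (intro le) auto
  qed (intro le; simp)+
  then have P: "?P (e a t)" unfolding eq by (rule LeastI)
  show ?thesis
  proof
    assume "e a t \<le> m" with P show "?P m" by (meson order_trans)
  next
    assume "?P m" then show "e a t \<le> m" unfolding eq by (rule Least_le)
  qed
qed

lemma e_ge_h: "a < t \<Longrightarrow> h t \<le> e a t"
  using e_low[of _ t a] e_high[of a t "e a t"] by (cases "\<exists>g\<in>accs t. a \<le> g") auto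

lemma upper_le: "a < t \<Longrightarrow> \<not> (\<exists>g\<in>accs t. a \<le> g) \<Longrightarrow> y \<in> upper a t \<Longrightarrow> z \<in> upper a t \<Longrightarrow> y < z \<Longrightarrow> e y z \<le> e a t"
  using e_high[of a t "e a t"] by blast

lemma upper_le': "a < t \<Longrightarrow> \<not> (\<exists>g\<in>accs t. a \<le> g) \<Longrightarrow> y \<in> upper a t \<Longrightarrow> z \<in> upper a t \<Longrightarrow> y \<le> z \<Longrightarrow> e y z \<le> e a t"
  using upper_le[of a t y z] by (cases "y = z") auto

lemma next_step_upper: "a < t \<Longrightarrow> \<not> (\<exists>g\<in>accs t. a \<le> g) \<Longrightarrow> next_step a t \<in> upper a t"
  using next_step_props[of a t] by (auto simp: upper_def not_le intro: less_imp_le order.strict_trans2)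

lemma next_step_le_e: "a < t \<Longrightarrow> \<not> (\<exists>g\<in>accs t. a \<le> g) \<Longrightarrow> e a (next_step a t) \<le> e a t"
  using e_high[of a t "e a t"] by blast

text \<open>Induction on the top ordinal. Both inequalities go together since each case compares two
  routes from \<open>a\<close>; weak order on the arguments admits next steps that coincide with
  \<open>a\<close> or \<open>b\<close>.\<close>

lemma subadd: "a \<le> b \<Longrightarrow> b \<le> t \<Longrightarrow> e a t \<le> max (e a b) (e b t) \<and> e a b \<le> max (e a t) (e b t)"
proof (induction t arbitrary: a b rule: less_induct)
  case (less t)
  consider "a = b" | "b = t" | "a < b" "b < t" using less.prems by force
  then show ?case
  proof cases
    case 3
    note ab = 3(1) and bt = 3(2)
    then have at: "a < t" by simp
    have IH1: "e x s \<le> max (e x y) (e y s)" if "x \<le> y" "y \<le> s" "s < t" for x y s using less.IH that by blast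
    have IH2: "e x y \<le> max (e x s) (e y s)" if "x \<le> y" "y \<le> s" "s < t" for x y s using less.IH that by blast
    show ?thesis
    proof (cases "\<exists>g\<in>accs t. b \<le> g")
      case True
      then obtain g where g: "g \<in> accs t" "b \<le> g" by blast
      have "e a t = max (h t) (e a g)" "e b t = max (h t) (e b g)" using e_low g ab by auto
      moreover have "e a g \<le> max (e a b) (e b g)" "e a b \<le> max (e a g) (e b g)"
        using IH1[of a b g] IH2[of a b g] ab g accs_coh(4) by auto
      ultimately show ?thesis by (auto simp: le_max_iff_disj)
    next
      case nb: False
      let ?n = "next_step b t"
      have n: "?n \<in> C t" "b \<le> ?n" "?n < t" using next_step_props[OF bt] by auto
      have nu: "?n \<in> upper b t" using next_step_upper[OF bt nb] .
      have ben: "e b ?n \<le> e b t" using next_step_le_e[OF bt nb] .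
      have hb: "h t \<le> e b t" using e_ge_h[OF bt] .
      have abn1: "e a ?n \<le> max (e a b) (e b ?n)" using IH1[of a b ?n] ab n by simp
      have abn2: "e a b \<le> max (e a ?n) (e b ?n)" using IH2[of a b ?n] ab n by simp
      show ?thesis
      proof (cases "\<exists>g\<in>accs t. a \<le> g")
        case True
        obtain g1 where g1: "g1 \<in> accs t" "a \<le> g1" using True by blast
        \<comment> \<open>\<open>g0\<close> is the last accumulation point of \<open>C t\<close>:
          the supremum of the accumulation points is again one, being at most
          \<open>b < t\<close>.\<close>
        define g0 where "g0 = (LEAST x. \<forall>y\<in>accs t. y \<le> x)"
        have ub: "\<forall>y\<in>accs t. y \<le> b" using nb by (meson nle_le)
        have g0ub: "\<forall>y\<in>accs t. y \<le> g0" unfolding g0_def by (rule LeastI[of _ b]) (rule ub)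
        have g0b: "g0 \<le> b" unfolding g0_def by (rule Least_le) (rule ub)
        have g0acc: "g0 \<in> accs t"
        proof (rule ccontr)
          assume no: "g0 \<notin> accs t"
          then have g1g0: "g1 < g0" using g0ub g1 by (metis order_le_less)
          have "limit_point (C t) g0" unfolding limit_point_def
          proof (intro conjI allI impI)
            show "\<exists>y. y < g0" using g1g0 by blast
            fix x assume "x < g0"
            then have "\<not> (\<forall>y\<in>accs t. y \<le> x)" unfolding g0_def by (rule not_less_Least)
            then obtain y where y: "y \<in> accs t" "x < y" by (auto simp: not_le)
            then have "y < g0" using g0ub no by (metis order_le_less)
            then show "\<exists>x'\<in>C t. x < x' \<and> x' < g0" using y accs_coh(3) by blast
          qed
          then show False using no g0b bt by (auto simp: accs_def)
        qed
        have ag0: "a \<le> g0" using g1 g0ub by (meson order_trans)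
        have g0b': "g0 < b" using g0b g0acc nb by (metis order_le_less order_refl)
        have eat: "e a t = max (h t) (e a g0)" using e_low[OF g0acc ag0] .
        have g0u: "g0 \<in> upper b t" using g0acc accs_coh(3) g0ub g0b n(2) by (auto simp: upper_def)
        \<comment> \<open>This is why \<open>e b t\<close> was made to bound the values on
          \<open>upper b t\<close>: passing through \<open>g0\<close> or through \<open>?n\<close>
          makes no difference up to \<open>e b t\<close>.\<close>
        have g0n: "e g0 ?n \<le> e b t" using upper_le'[OF bt nb g0u nu] g0b n by simp
        have "e a g0 \<le> max (e a ?n) (e g0 ?n)" using IH2[of a g0 ?n] ag0 g0b n by simp
        moreover have "e a ?n \<le> max (e a g0) (e g0 ?n)" using IH1[of a g0 ?n] ag0 g0b n by simp
        ultimately show ?thesis using eat g0n abn1 abn2 ben hb by (auto simp: le_max_iff_disj max_def split: if_splits)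
      next
        case na: False
        let ?m = "next_step a t"
        have m: "?m \<in> C t" "a \<le> ?m" "?m < t" using next_step_props[OF at] by auto
        have mn: "?m \<le> ?n" using next_step_props(4)[OF at] n ab by (meson less_imp_le order_trans)
        have mu: "?m \<in> upper a t" using next_step_upper[OF at na] .
        \<comment> \<open>Both steps lie above the last accumulation point, so \<open>e b t\<close>
          bounds every value that enters \<open>e a t\<close> through
          \<open>upper a t\<close>.\<close>
        have sub: "upper a t \<subseteq> upper b t" using mn by (auto simp: upper_def)
        have aem: "e a ?m \<le> e a t" using next_step_le_e[OF at na] .
        have emn: "e ?m ?n \<le> e b t" using upper_le'[OF bt nb _ nu mn] mu sub by blast
        have "e a ?m \<le> max (e a ?n) (e ?m ?n)" using IH2[of a ?m ?n] m mn n by simp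
        then have 1: "e a ?m \<le> max (e a b) (e b t)" using abn1 ben emn by (auto simp: le_max_iff_disj max_def split: if_splits)
        have "e a t \<le> max (e a b) (e b t)" unfolding e_high[OF at na]
        proof (intro conjI ballI impI)
          show "h t \<le> max (e a b) (e b t)" using hb by (simp add: le_max_iff_disj)
          show "e a ?m \<le> max (e a b) (e b t)" by fact
          fix y z assume "y \<in> upper a t" "z \<in> upper a t" "y < z"
          then have "e y z \<le> e b t" using upper_le[OF bt nb] sub by blast
          then show "e y z \<le> max (e a b) (e b t)" by (simp add: le_max_iff_disj)
        qed
        moreover have "e a ?n \<le> max (e a ?m) (e ?m ?n)" using IH1[of a ?m ?n] m mn n by simp
        then have "e a b \<le> max (e a t) (e b t)"
          using aem emn abn2 ben by (auto simp: le_max_iff_disj max_def split: if_splits)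
        ultimately show ?thesis by blast
      qed
    qed
  qed auto
qed

lemmas e_triangle_top = subadd[THEN conjunct1] and e_triangle_bottom = subadd[THEN conjunct2]

text \<open>Induction on \<open>t\<close>. At or below an accumulation point, \<open>e_low\<close>
  passes to a smaller ordinal; above them all, only the value at the next step varies near
  \<open>d\<close>, and that step is below \<open>t\<close>.\<close>

lemma e_closed: "limit_point {a. a < t \<and> e a t \<le> i} d \<Longrightarrow> d < t \<Longrightarrow> e d t \<le> i"
proof (induction t arbitrary: d rule: less_induct)
  case (less t)
  let ?X = "{a. a < t \<and> e a t \<le> i}"
  obtain a0 where a0: "a0 \<in> ?X" "a0 < d" using less.prems(1) unfolding limit_point_def by blast
  have ht: "h t \<le> i" using e_ge_h[of a0 t] a0(1) by auto
  show ?case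
  proof (cases "\<exists>g\<in>accs t. d \<le> g")
    case True
    then obtain g where g: "g \<in> accs t" "d \<le> g" by blast
    have "e d g \<le> i"
    proof (cases "d = g")
      case False
      have "limit_point {a. a < g \<and> e a g \<le> i} d"
        by (rule limit_point_mono[OF less.prems(1) _ a0(2)]) (use g e_low[OF g(1)] in auto)
      then show ?thesis using less.IH[of g d] g False accs_coh(4) by auto
    qed simp
    then show ?thesis using e_low[OF g] ht by simp
  next
    case False
    let ?n = "next_step d t"
    have n: "?n \<in> C t" "d \<le> ?n" "?n < t" using next_step_props[OF less.prems(2)] by auto
    have "\<not> limit_point (C t) d" using False less.prems(2) by (auto simp: accs_def)
    then obtain g where g: "g < d" "\<forall>x\<in>C t. x < d \<longrightarrow> x \<le> g" using non_limit_point_bound a0(2) by blast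
    have acc_le: "x \<le> g" if "x \<in> accs t" for x
    proof -
      have "x < d" using that False by (meson not_le)
      then show ?thesis using g accs_coh(3)[OF that] by blast
    qed
    \<comment> \<open>No element of \<open>C t\<close> lies strictly between \<open>g\<close> and
      \<open>d\<close>, so all \<open>a\<close> there share their next step and upper set with
      \<open>d\<close>.\<close>
    have same: "\<not> (\<exists>g\<in>accs t. a \<le> g)" "next_step a t = ?n" "upper a t = upper d t" if a: "g < a" "a < d" for a
    proof -
      show "\<not> (\<exists>g\<in>accs t. a \<le> g)" using acc_le a by (meson leD order.strict_trans2 order.strict_trans1 not_le)
      show eq: "next_step a t = ?n"
      proof (rule next_step_eq)
        show "?n \<in> C t" by fact
        show "a \<le> ?n" using a n by simp
        fix y assume y: "y \<in> C t" "a \<le> y"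
        then have "\<not> y < d" using g a by (meson leD order.strict_trans2)
        then show "?n \<le> y" using next_step_props(4)[OF less.prems(2)] y by simp
      qed
      show "upper a t = upper d t" by (simp add: upper_def eq)
    qed
    obtain a1 where a1: "a1 \<in> ?X" "g < a1" "a1 < d" using less.prems(1) g unfolding limit_point_def by blast
    have cond: "e a1 t \<le> i" using a1 by simp
    have "a1 < t" using a1 by simp
    note c1 = cond[unfolded e_high[OF this same(1)[OF a1(2,3)]] same(2,3)[OF a1(2,3)]]
    have "e d ?n \<le> i"
    proof (cases "d = ?n")
      case False
      have "limit_point {a. a < ?n \<and> e a ?n \<le> i} d"
      proof (rule limit_point_mono[OF less.prems(1) _ g(1)])
        fix x assume x: "x \<in> ?X" "x < d" "g < x"
        have "x < t" "e x t \<le> i" using x by auto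
        from this(2)[unfolded e_high[OF this(1) same(1)[OF x(3,2)]] same(2,3)[OF x(3,2)]]
        show "x \<in> {a. a < ?n \<and> e a ?n \<le> i}" using x n by auto
      qed
      then show ?thesis using less.IH[of ?n d] n False by simp
    qed (metis ebot_le e_refl)
    with c1 show ?thesis unfolding e_high[OF less.prems(2) False] by blast
  qed
qed

text \<open>If \<open>i\<close> bounded all values on \<open>X\<close>, a club of ordinals would
  have values at most \<open>i\<close> at all later points of \<open>X\<close>. A \<open>d\<close>
  in it with \<open>i < h d\<close> contradicts \<open>h d \<le> e x0 d\<close> by
  subadditivity.\<close>

lemma e_unbounded:
  assumes "unbounded X"
  shows "\<exists>a\<in>X. \<exists>b\<in>X. a < b \<and> i < e a b"
proof (rule ccontr)
  assume no: "\<not> ?thesis"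
  then have X: "e a b \<le> i" if "a \<in> X" "b \<in> X" "a < b" for a b using that by (meson not_le)
  define T where "T = {a. \<forall>b\<in>X. a < b \<longrightarrow> e a b \<le> i}"
  have XT: "X \<subseteq> T" using X by (auto simp: T_def)
  have "club T" unfolding club_def
  proof (intro conjI allI impI)
    fix d assume d: "limit_point T d"
    show "d \<in> T" unfolding T_def
    proof (intro CollectI ballI impI)
      fix b assume b: "b \<in> X" "d < b"
      have "limit_point {a. a < b \<and> e a b \<le> i} d"
        by (rule limit_point_subset[OF d]) (use b in \<open>auto simp: T_def\<close>)
      then show "e d b \<le> i" using e_closed b by blast
    qed
  next
    fix g obtain x where "x \<in> X" "g < x" using assms unfolding unbounded_def by blast
    then show "\<exists>x\<in>T. g < x" using XT by blast
  qed
  moreover obtain x0 where x0: "x0 \<in> X" using assms unfolding unbounded_def by blast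
  ultimately have "club (T \<inter> {x. x0 < x})" using club_greater club_Int by blast
  then obtain d where d: "d \<in> T" "x0 < d" "i < h d" using h_stationary[of i] unfolding stationary_def by blast
  obtain b where b: "b \<in> X" "d < b" using assms unfolding unbounded_def by blast
  have "e x0 b \<le> i" "e d b \<le> i" using d b x0 XT by (auto simp: T_def)
  moreover have "e x0 d \<le> max (e x0 b) (e d b)" using e_triangle_bottom[of x0 d b] d(2) b(2) by simp
  ultimately have "e x0 d \<le> i" by (meson max.bounded_iff order_trans)
  moreover have "h d \<le> e x0 d" using e_ge_h d by blast
  ultimately show False using d by simp
qed

end

subsection \<open>Walks and their lower traces\<close>

context coherent_system
begin

text \<open>The supremum of \<open>C b \<inter> {..<a}\<close>, with value 0 for the empty
  set.\<close>

definition last_below :: "'k \<Rightarrow> 'k \<Rightarrow> 'k" where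
  "last_below a b = (LEAST g. \<forall>x\<in>C b. x < a \<longrightarrow> x \<le> g)"

lemma last_below_ge: "x \<in> C b \<Longrightarrow> x < a \<Longrightarrow> x \<le> last_below a b"
proof -
  have "\<forall>x\<in>C b. x < a \<longrightarrow> x \<le> last_below a b"
    unfolding last_below_def by (rule LeastI[of _ a]) auto
  then show "x \<in> C b \<Longrightarrow> x < a \<Longrightarrow> x \<le> last_below a b" by blast
qed

lemma last_below_less: "a0 < a \<Longrightarrow> \<not> limit_point (C b) a \<Longrightarrow> last_below a b < a"
proof -
  assume "a0 < a" "\<not> limit_point (C b) a"
  then obtain g where "g < a" "\<forall>x\<in>C b. x < a \<longrightarrow> x \<le> g" using non_limit_point_bound by blast
  then show ?thesis unfolding last_below_def using Least_le[of "\<lambda>g. \<forall>x\<in>C b. x < a \<longrightarrow> x \<le> g" g] by simp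
qed

lemma last_below_cong: "C b \<inter> {..<a} = C b' \<inter> {..<a'} \<Longrightarrow> last_below a b = last_below a' b'"
proof -
  assume "C b \<inter> {..<a} = C b' \<inter> {..<a'}"
  then have "(\<forall>x\<in>C b. x < a \<longrightarrow> x \<le> g) \<longleftrightarrow> (\<forall>x\<in>C b'. x < a' \<longrightarrow> x \<le> g)" for g by blast
  then show ?thesis by (simp add: last_below_def)
qed

text \<open>Todorcevic's lower trace as the list of running maxima of \<open>last_below a\<close>
  along the walk. It halts where \<open>a\<close> is a limit point of the current club, since the
  supremum there would be \<open>a\<close> itself.\<close>

function lower_trace :: "'k \<Rightarrow> 'k \<Rightarrow> 'k list" where
  "lower_trace a b = (if a < b \<and> \<not> limit_point (C b) a then last_below a b # map (max (last_below a b)) (lower_trace a (next_step a b)) else [])"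
  by pat_completeness auto
termination
  by (relation "inv_image {(x, y). x < y} snd") (auto simp: next_step_props intro: wf)

function walk :: "'k \<Rightarrow> 'k \<Rightarrow> 'k list" where
  "walk a b = (if a < b then b # walk a (next_step a b) else [])"
  by pat_completeness auto
termination
  by (relation "inv_image {(x, y). x < y} snd") (auto simp: next_step_props intro: wf)

function walk_end :: "'k \<Rightarrow> 'k \<Rightarrow> 'k" where
  "walk_end a b = (if a < b \<and> \<not> limit_point (C b) a then walk_end a (next_step a b) else b)"
  by pat_completeness auto
termination
  by (relation "inv_image {(x, y). x < y} snd") (auto simp: next_step_props intro: wf)

declare lower_trace.simps [simp del] walk.simps [simp del] walk_end.simps [simp del]

lemma lower_trace_Nil_iff: "lower_trace a b = [] \<longleftrightarrow> \<not> (a < b \<and> \<not> limit_point (C b) a)"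
  by (subst lower_trace.simps) auto

lemma lower_trace_less: "a0 < a \<Longrightarrow> x \<in> set (lower_trace a b) \<Longrightarrow> x < a"
proof (induction a b arbitrary: x rule: lower_trace.induct)
  case (1 a b)
  have ab: "a < b \<and> \<not> limit_point (C b) a" using 1(3) lower_trace_Nil_iff[of a b] by auto
  then have "lower_trace a b = last_below a b # map (max (last_below a b)) (lower_trace a (next_step a b))" by (subst lower_trace.simps) simp
  then consider "x = last_below a b" | y where "y \<in> set (lower_trace a (next_step a b))" "x = max (last_below a b) y" using 1(3) by auto
  then show ?case
    using 1(1)[OF ab 1(2)] last_below_less[OF 1(2)] ab by cases auto
qed

lemma lower_trace_ge: "x \<in> set (lower_trace a b) \<Longrightarrow> last_below a b \<le> x"
  by (subst (asm) lower_trace.simps) (auto split: if_splits)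

lemma next_step_coh:
  assumes "limit_point (C b) d" "d < b" "a < d"
  shows "next_step a b = next_step a d" "last_below a b = last_below a d" "limit_point (C b) a \<longleftrightarrow> limit_point (C d) a"
proof -
  have C: "C d = C b \<inter> {..<d}" using C_coh assms by blast
  have n: "next_step a d \<in> C d" "a \<le> next_step a d" "next_step a d < d" using next_step_props[OF assms(3)] by auto
  show "next_step a b = next_step a d"
  proof (rule next_step_eq)
    show "next_step a d \<in> C b" using n C by blast
    show "a \<le> next_step a d" by fact
    fix y assume y: "y \<in> C b" "a \<le> y"
    show "next_step a d \<le> y"
    proof (cases "y < d")
      case True
      then show ?thesis using next_step_props(4)[OF assms(3)] y C by blast
    next
      case False
      then show ?thesis using n(3) by simp
    qed
  qed
  show "last_below a b = last_below a d" using assms(3) by (intro last_below_cong) (auto simp: C)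
  show "limit_point (C b) a \<longleftrightarrow> limit_point (C d) a" unfolding C using limit_point_Int[OF less_imp_le[OF assms(3)]] by simp
qed

lemma lower_trace_coh:
  assumes "limit_point (C b) d" "d < b" "a < d"
  shows "lower_trace a b = lower_trace a d"
  using next_step_coh[OF assms] assms by (subst (1 2) lower_trace.simps) auto

text \<open>\<open>C b\<close> has no element in \<open>[a, d)\<close>, so it looks the same from
  \<open>a\<close> and from \<open>d\<close>.\<close>

lemma walk_step:
  assumes "d < b" "\<not> limit_point (C b) d" "last_below d b < a" "a < d"
  shows "next_step a b = next_step d b" "last_below a b = last_below d b" "\<not> limit_point (C b) a"
proof -
  have gap: "\<not> (a \<le> x \<and> x < d)" if "x \<in> C b" for x
    using last_below_ge[OF that, of d] assms(3) by (meson leD order.strict_trans2)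
  have n: "next_step d b \<in> C b" "d \<le> next_step d b" using next_step_props[OF assms(1)] by auto
  show "next_step a b = next_step d b"
  proof (rule next_step_eq)
    show "next_step d b \<in> C b" by fact
    show "a \<le> next_step d b" using n assms(4) by simp
    fix y assume "y \<in> C b" "a \<le> y"
    then show "next_step d b \<le> y" using gap next_step_props(4)[OF assms(1), of y] by (meson not_le)
  qed
  have "C b \<inter> {..<a} = C b \<inter> {..<d}"
  proof (rule set_eqI)
    fix x show "x \<in> C b \<inter> {..<a} \<longleftrightarrow> x \<in> C b \<inter> {..<d}"
      using gap[of x] assms(4) by (cases "x < a") auto
  qed
  then show "last_below a b = last_below d b" by (rule last_below_cong)
  show "\<not> limit_point (C b) a"
  proof
    assume "limit_point (C b) a"
    then obtain x where "x \<in> C b" "last_below d b < x" "x < a" using assms(3) unfolding limit_point_def by blast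
    moreover then have "x < d" using assms(4) by simp
    ultimately show False using last_below_ge[of x b d] by simp
  qed
qed

text \<open>The walk to \<open>a\<close> follows the walk to \<open>d\<close> until that one stops,
  at \<open>d\<close> or at an ordinal whose club extends \<open>C d\<close>; from there it proceeds
  as from \<open>d\<close>. The second bound makes the running maxima act trivially on the
  tail.\<close>

lemma lower_trace_append:
  assumes "d \<le> b" "a < d" "\<forall>x\<in>set (lower_trace d b). x < a" "\<forall>x\<in>set (lower_trace d b). \<forall>y\<in>set (lower_trace a d). x \<le> y"
  shows "lower_trace a b = lower_trace d b @ lower_trace a d"
  using assms
proof (induction d b rule: lower_trace.induct)
  case (1 d b)
  show ?case
  proof (cases "d < b \<and> \<not> limit_point (C b) d")
    case True
    let ?l = "last_below d b" and ?n = "next_step d b"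
    have eq: "lower_trace d b = ?l # map (max ?l) (lower_trace d ?n)" using True by (subst lower_trace.simps) simp
    have l: "?l < a" using "1.prems"(3) unfolding eq by simp
    note w = walk_step[OF _ _ l \<open>a < d\<close>]
    have IH: "lower_trace a ?n = lower_trace d ?n @ lower_trace a d"
    proof (rule "1.IH"[OF True])
      show "d \<le> ?n" using next_step_props True by blast
      show "a < d" by fact
      show "\<forall>x\<in>set (lower_trace d ?n). x < a" using "1.prems"(3) unfolding eq by simp
      show "\<forall>x\<in>set (lower_trace d ?n). \<forall>y\<in>set (lower_trace a d). x \<le> y" using "1.prems"(4) unfolding eq by simp
    qed
    have "max ?l y = y" if "y \<in> set (lower_trace a d)" for y
      using "1.prems"(4) that unfolding eq by (simp add: max_absorb2)
    then have m: "map (max ?l) (lower_trace a d) = lower_trace a d" by (simp add: map_idI)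
    have "lower_trace a b = ?l # map (max ?l) (lower_trace a ?n)"
      using w True \<open>a < d\<close> by (subst lower_trace.simps) auto
    then show ?thesis unfolding IH eq by (simp add: m)
  next
    case False
    then have "lower_trace d b = []" by (simp add: lower_trace_Nil_iff)
    moreover have "lower_trace a b = lower_trace a d" using False "1.prems" lower_trace_coh by (cases "d = b") auto
    ultimately show ?thesis by simp
  qed
qed

text \<open>Each trace entry stands for one step common to both walks, so the length of the trace is
  the index at which the walk to \<open>d\<close> stops.\<close>

lemma walk_nth:
  assumes "d \<le> b" "a < d" "\<forall>x\<in>set (lower_trace d b). x < a"
  shows "walk a b ! length (lower_trace d b) = walk_end d b"
  using assms
proof (induction d b rule: lower_trace.induct)
  case (1 d b)
  have ab: "a < b" using "1.prems"(1,2) by simp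
  show ?case
  proof (cases "d < b \<and> \<not> limit_point (C b) d")
    case True
    let ?l = "last_below d b" and ?n = "next_step d b"
    have eq: "lower_trace d b = ?l # map (max ?l) (lower_trace d ?n)" using True by (subst lower_trace.simps) simp
    have l: "?l < a" using "1.prems"(3) unfolding eq by simp
    note w = walk_step[OF _ _ l \<open>a < d\<close>]
    have IH: "walk a ?n ! length (lower_trace d ?n) = walk_end d ?n"
    proof (rule "1.IH"[OF True])
      show "d \<le> ?n" using next_step_props True by blast
      show "a < d" by fact
      show "\<forall>x\<in>set (lower_trace d ?n). x < a" using "1.prems"(3) unfolding eq by simp
    qed
    have "walk a b = b # walk a ?n" using w True ab by (subst walk.simps) auto
    moreover have "walk_end d b = walk_end d ?n" using True by (subst walk_end.simps) simp
    ultimately show ?thesis using IH eq by simp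
  next
    case False
    then have "lower_trace d b = []" by (simp add: lower_trace_Nil_iff)
    moreover have "walk_end d b = b" by (subst walk_end.simps) (use False in auto)
    moreover have "walk a b = b # walk a (next_step a b)" using ab by (subst walk.simps) simp
    ultimately show ?thesis by simp
  qed
qed

lemma walk_end_label:
  assumes "d \<le> b" "\<And>b g. limit_point (C b) g \<Longrightarrow> g < b \<Longrightarrow> f g = f b"
  shows "f (walk_end d b) = f d"
  using assms(1)
proof (induction d b rule: walk_end.induct)
  case (1 d b)
  show ?case
  proof (cases "d < b \<and> \<not> limit_point (C b) d")
    case True
    then show ?thesis using "1.IH"[OF True] next_step_props by (subst walk_end.simps) auto
  next
    case False
    then have "walk_end d b = b" by (subst walk_end.simps) auto
    then show ?thesis using False 1 assms(2)[of b d] by (cases "d = b") auto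
  qed
qed

end

section \<open>Lengths of chains of value pairs\<close>

text \<open>
  In a chain, \<open>(u, v)\<close> may be followed by \<open>(u', v')\<close> if \<open>max u v < v'\<close>; the argument \<open>t\<close> is a lower
  bound for the second component of the first element.
\<close>

fun max_chain :: "(nat \<times> nat) list \<Rightarrow> nat \<Rightarrow> nat" where
  "max_chain [] t = 0"
| "max_chain ((u, v) # xs) t = (if t \<le> v then max (max_chain xs t) (Suc (max_chain xs (Suc (max u v)))) else max_chain xs t)"

lemma max_chain_anti: "t \<le> t' \<Longrightarrow> max_chain xs t' \<le> max_chain xs t"
proof (induction xs arbitrary: t t')
  case (Cons x xs)
  obtain u v where x: "x = (u, v)" by force
  have "max_chain xs t' \<le> max_chain xs t" using Cons by simp
  then show ?case using Cons.prems by (auto simp: x max_def)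
qed simp

lemma max_chain_append_le: "max_chain (xs @ ys) t \<le> max_chain xs t + max_chain ys 0"
proof (induction xs arbitrary: t)
  case Nil
  then show ?case by (simp add: max_chain_anti)
next
  case (Cons x xs)
  obtain u v where x: "x = (u, v)" by force
  show ?case using Cons.IH[of t] Cons.IH[of "Suc (max u v)"] by (auto simp: x)
qed

text \<open>A chain in \<open>xs\<close> leaves a threshold of at most \<open>k\<close>, so any
  chain in \<open>ys\<close> that starts at threshold \<open>k\<close> may follow it.\<close>

lemma max_chain_append_ge:
  assumes "\<forall>(u, v)\<in>set xs. u < k \<and> v < k" "t \<le> k"
  shows "max_chain xs t + max_chain ys k \<le> max_chain (xs @ ys) t"
  using assms
proof (induction xs arbitrary: t)
  case Nil
  then show ?case by (simp add: max_chain_anti)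
next
  case (Cons x xs)
  obtain u v where x: "x = (u, v)" by force
  have "max_chain xs t + max_chain ys k \<le> max_chain (xs @ ys) t" using Cons by auto
  moreover have "max_chain xs (Suc (max u v)) + max_chain ys k \<le> max_chain (xs @ ys) (Suc (max u v))"
    using Cons.prems by (intro Cons.IH) (auto simp: x)
  ultimately show ?case by (auto simp: x)
qed

lemma max_chain_append_skip: "max_chain ys t \<le> max_chain (xs @ ys) t"
proof (induction xs)
  case (Cons x xs)
  obtain u v where x: "x = (u, v)" by force
  then show ?case using Cons by auto
qed simp

lemma max_chain_ge_threshold: "\<forall>(u, v)\<in>set xs. k \<le> v \<Longrightarrow> max_chain xs k = max_chain xs 0"
proof (induction xs)
  case (Cons x xs)
  then show ?case by (cases x) auto
qed simp

lemma max_chain_zero: "\<forall>(u, v)\<in>set xs. v < t \<Longrightarrow> max_chain xs t = 0"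
  by (induction xs t rule: max_chain.induct) auto

text \<open>One element already raises the threshold above \<open>V\<close>, hence above all second
  components.\<close>

lemma max_chain_le_1: "\<forall>(u, v)\<in>set xs. v \<le> V \<and> V < u \<Longrightarrow> max_chain xs t \<le> 1"
proof (induction xs)
  case (Cons x xs)
  obtain u v where x: "x = (u, v)" by force
  have "max_chain xs (Suc (max u v)) = 0" by (rule max_chain_zero) (use Cons.prems in \<open>auto simp: x\<close>)
  then show ?case using Cons by (auto simp: x)
qed simp

lemma max_chain_ge_1: "(u, v) \<in> set xs \<Longrightarrow> t \<le> v \<Longrightarrow> 1 \<le> max_chain xs t"
  by (induction xs t rule: max_chain.induct) auto

section \<open>The ruler function\<close>

text \<open>For \<open>c < 2\<close> the \<open>LEAST\<close> is over the empty predicate; these values are irrelevant.\<close>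

definition ruler :: "nat \<Rightarrow> nat" where
  "ruler c = (LEAST i. \<not> 2 ^ Suc i dvd c div 2)"

lemma ruler_eq: "c div 2 = 2 ^ v * (2 * q + 1) \<Longrightarrow> ruler c = v"
  unfolding ruler_def
proof (rule Least_equality)
  assume c: "c div 2 = 2 ^ v * (2 * q + 1)"
  have "\<not> 2 ^ v * 2 dvd 2 ^ v * (2 * q + 1)"
    by (simp only: nat_mult_dvd_cancel_disj) simp
  then show "\<not> 2 ^ Suc v dvd c div 2" unfolding c by (simp add: mult.commute)
  fix i assume i: "\<not> 2 ^ Suc i dvd c div 2"
  show "v \<le> i"
  proof (rule ccontr)
    assume "\<not> v \<le> i"
    then have "(2::nat) ^ Suc i dvd 2 ^ v" by (intro le_imp_power_dvd) simp
    then show False using i unfolding c by (meson dvd_mult2)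
  qed
qed

text \<open>The pairs \<open>2 * m\<close>, \<open>2 * m + 1\<close> with \<open>m\<close> an odd
  multiple of \<open>2 ^ v\<close> recur with period \<open>M\<close>. Halving absorbs the error of
  one with which \<open>max_chain\<close> will be known.\<close>

lemma ruler_hit: "\<exists>k\<le>2 ^ (v + 3). \<forall>c. c = l + k \<or> c = l + k + 1 \<longrightarrow> ruler c = v"
proof -
  define M :: nat where "M = 2 ^ (v + 2)"
  define q where "q = l div M + 1"
  define m where "m = 2 ^ v * (2 * q + 1)"
  have m2: "2 * m = M * q + 2 ^ (v + 1)" by (simp add: m_def M_def algebra_simps)
  have "l = M * (l div M) + l mod M" "l mod M < M" by (simp_all add: M_def)
  moreover have "M * q = M * (l div M) + M" by (simp add: q_def)
  moreover have "(2::nat) ^ (v + 1) \<le> M" "2 ^ (v + 3) = 2 * M" by (simp_all add: M_def power_add)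
  ultimately have lm: "l \<le> 2 * m" "2 * m - l \<le> 2 ^ (v + 3)" using m2 by linarith+
  have "ruler c = v" if "c = l + (2 * m - l) \<or> c = l + (2 * m - l) + 1" for c
  proof (rule ruler_eq[of _ _ q])
    have "c = 2 * m \<or> c = 2 * m + 1" using that lm by simp
    then show "c div 2 = 2 ^ v * (2 * q + 1)" unfolding m_def[symmetric] by auto
  qed
  then show ?thesis using lm by blast
qed

subsection \<open>Raising values along walks\<close>

locale nat_labelled_system = labelled_system K C h for K :: "'k::wellorder itself" and C :: "'k \<Rightarrow> 'k set" and h :: "'k \<Rightarrow> nat"
begin

lemma ebot_0: "ebot = 0"
  using ebot_le[of 0] by simp

definition value_pairs :: "'k \<Rightarrow> 'k \<Rightarrow> 'k list \<Rightarrow> (nat \<times> nat) list" where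
  "value_pairs a b F = map (\<lambda>x. (e x a, e x b)) F"

definition trace_colour :: "'k \<Rightarrow> 'k \<Rightarrow> nat" where
  "trace_colour a b = ruler (max_chain (value_pairs a b (lower_trace a b)) 0)"

lemma value_pairs_append: "value_pairs a b (F @ G) = value_pairs a b F @ value_pairs a b G"
  by (simp add: value_pairs_def)

lemma value_pairs_zip: "value_pairs a b F = zip (map (\<lambda>x. e x a) F) (map (\<lambda>x. e x b) F)"
  by (induction F) (auto simp: value_pairs_def)

text \<open>Otherwise every \<open>d\<close> in a club is, for each later \<open>a \<in> A\<close>,
  a limit of points with value at most \<open>J\<close> at \<open>a\<close>; by
  \<open>e_closed\<close> and subadditivity \<open>e\<close> is then bounded by \<open>J\<close> on
  the club.\<close>

lemma high_on_segment:
  assumes "unbounded A"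
  shows "\<exists>\<eta>. \<forall>\<gamma>. \<exists>a\<in>A. \<gamma> < a \<and> (\<forall>x. \<eta> \<le> x \<and> x < \<gamma> \<longrightarrow> J < e x a)"
proof (rule ccontr)
  assume "\<not> ?thesis"
  then have "\<forall>\<eta>. \<exists>\<gamma>. \<forall>a\<in>A. \<gamma> < a \<longrightarrow> (\<exists>x. \<eta> \<le> x \<and> x < \<gamma> \<and> e x a \<le> J)" by (meson not_le)
  then obtain \<gamma> where \<gamma>: "\<And>\<eta> a. a \<in> A \<Longrightarrow> \<gamma> \<eta> < a \<Longrightarrow> \<exists>x. \<eta> \<le> x \<and> x < \<gamma> \<eta> \<and> e x a \<le> J" by metis
  define D where "D = {d. limit_point UNIV d} \<inter> {d. \<forall>g<d. \<gamma> g < d}"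
  have "club D" unfolding D_def by (rule club_Int[OF club_limits club_closure])
  then have "unbounded D" by (simp add: club_def unbounded_def)
  then obtain d d' where d: "d \<in> D" "d' \<in> D" "d < d'" "J < e d d'" using e_unbounded by blast
  obtain a where a: "a \<in> A" "d' < a" using assms unfolding unbounded_def by blast
  have low: "e d a \<le> J" if da: "d \<in> D" "d < a" for d
  proof -
    have "limit_point {x. x < a \<and> e x a \<le> J} d" unfolding limit_point_def
    proof (intro conjI allI impI)
      show "\<exists>y. y < d" using da by (auto simp: D_def limit_point_def)
      fix g assume "g < d"
      then obtain g' where g': "g < g'" "g' < d" using da by (auto simp: D_def limit_point_def)
      then have gd: "\<gamma> g' < d" using da g' by (auto simp: D_def)
      then have "\<gamma> g' < a" using da(2) by simp
      then obtain x where x: "g' \<le> x" "x < \<gamma> g'" "e x a \<le> J" using \<gamma>[OF a(1)] by blast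
      have "g < x" "x < d" using x g' gd by (meson order.strict_trans order.strict_trans2)+
      then show "\<exists>x\<in>{x. x < a \<and> e x a \<le> J}. g < x \<and> x < d" using x(3) da(2) by (intro bexI[of _ x]) auto
    qed
    then show ?thesis using e_closed da by blast
  qed
  have "e d d' \<le> max (e d a) (e d' a)" using e_triangle_bottom[of d d' a] d a by simp
  moreover have "e d a \<le> J" "e d' a \<le> J" using low d a by auto
  ultimately show False using d(4) by simp
qed

lemma uniformly_high_on_segment:
  assumes "unbounded A"
  shows "\<exists>\<eta>. \<forall>J \<gamma>. \<exists>a\<in>A. \<gamma> < a \<and> (\<forall>x. \<eta> \<le> x \<and> x < \<gamma> \<longrightarrow> J < e x a)"
proof -
  from high_on_segment[OF assms] obtain f
    where f: "\<And>J \<gamma>. \<exists>a\<in>A. \<gamma> < a \<and> (\<forall>x. f J \<le> x \<and> x < \<gamma> \<longrightarrow> J < e x a)" by metis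
  obtain \<eta> where \<eta>: "\<forall>J. f J < \<eta>" using countable_bounded by blast
  have "\<exists>a\<in>A. \<gamma> < a \<and> (\<forall>x. \<eta> \<le> x \<and> x < \<gamma> \<longrightarrow> J < e x a)" for J \<gamma>
  proof -
    obtain a where a: "a \<in> A" "\<gamma> < a" "\<forall>x. f J \<le> x \<and> x < \<gamma> \<longrightarrow> J < e x a" using f by blast
    have "f J \<le> x" if "\<eta> \<le> x" for x using \<eta> that by (meson less_imp_le order_trans)
    with a show ?thesis by blast
  qed
  then show ?thesis by blast
qed

text \<open>Closedness, applied to the bound \<open>e d b - 1\<close>, yields
  \<open>e d b \<le> e x b\<close> just below \<open>d\<close>; subadditivity then forces the
  maximum.\<close>

lemma e_near_limit:
  assumes "y < d" "d \<le> b"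
  shows "\<exists>g<d. \<forall>x. g < x \<and> x < d \<longrightarrow> e x b = max (e d b) (e x d)"
proof -
  have "\<exists>g<d. \<forall>x. g < x \<and> x < d \<longrightarrow> e d b \<le> e x b"
  proof (cases "e d b = 0")
    case True
    then show ?thesis using assms(1) by auto
  next
    case False
    then have "d < b" using assms(2) ebot_0 by (cases "d = b") auto
    then have "\<not> limit_point {a. a < b \<and> e a b \<le> e d b - 1} d" using e_closed[of b "e d b - 1" d] False by auto
    then obtain g where g: "g < d" "\<forall>x\<in>{a. a < b \<and> e a b \<le> e d b - 1}. x < d \<longrightarrow> x \<le> g"
      using non_limit_point_bound assms(1) by blast
    have "e d b \<le> e x b" if "g < x" "x < d" for x
    proof (rule ccontr)
      assume "\<not> e d b \<le> e x b"
      then have "x \<in> {a. a < b \<and> e a b \<le> e d b - 1}" using \<open>d < b\<close> that by auto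
      then show False using g that by force
    qed
    then show ?thesis using g by blast
  qed
  then obtain g where g: "g < d" "\<forall>x. g < x \<and> x < d \<longrightarrow> e d b \<le> e x b" by blast
  have "e x b = max (e d b) (e x d)" if "g < x" "x < d" for x
  proof -
    have "e x b \<le> max (e x d) (e d b)" "e x d \<le> max (e x b) (e d b)" "e d b \<le> e x b"
      using e_triangle_top[of x d b] e_triangle_bottom[of x d b] g that assms(2) by auto
    then show ?thesis by linarith
  qed
  then show ?thesis using g(1) by blast
qed

text \<open>Almost every \<open>d \<in> S\<close> has a partner \<open>\<sigma> d \<in> S\<close>
  with large value at \<open>d\<close>: on a stationary set of exceptions Fodor's lemma would put
  one \<open>x0 > \<eta>\<close> into all \<open>C d\<close>, and \<open>e_unbounded\<close> would
  supply a partner. Fodor's lemma for lists then fixes the trace.\<close>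

lemma raise_values:
  assumes S: "stationary S" and lim: "\<And>d. d \<in> S \<Longrightarrow> limit_point UNIV d" and H: "\<And>d. d \<in> S \<Longrightarrow> h d = H"
  shows "\<exists>S' N \<sigma>. stationary S' \<and> S' \<subseteq> S \<and> N \<noteq> [] \<and> (\<forall>x\<in>set N. \<eta> < x) \<and>
    (\<forall>d\<in>S'. \<sigma> d \<in> S \<and> d < \<sigma> d \<and> m < e d (\<sigma> d) \<and> lower_trace d (\<sigma> d) = N \<and> (\<forall>x\<in>set N. x < d))"
proof -
  define m' where "m' = max m H"
  define Q where "Q d d' \<longleftrightarrow> d' \<in> S \<and> d < d' \<and> m' < e d d' \<and> (\<exists>x\<in>C d'. \<eta> < x \<and> x < d)" for d d'
  let ?P = "{d\<in>S. \<nexists>d'. Q d d'}"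
  have "\<not> stationary ?P"
  proof
    assume "stationary ?P"
    then have P1: "stationary {d\<in>?P. \<eta> < d}" by (rule stationary_greater)
    have "\<exists>x<d. x \<in> C d \<and> \<eta> < x" if "d \<in> {d\<in>?P. \<eta> < d}" for d
    proof -
      have "limit_point (C d) d" using lim limit_point_C that by blast
      then show ?thesis using that unfolding limit_point_def by blast
    qed
    from fodor_ex[OF P1 this] obtain P2 x0
      where P2: "stationary P2" "P2 \<subseteq> {d\<in>?P. \<eta> < d}" "\<forall>d\<in>P2. x0 < d \<and> x0 \<in> C d \<and> \<eta> < x0" by blast
    obtain d d' where d: "d \<in> P2" "d' \<in> P2" "d < d'" "m' < e d d'"
      using e_unbounded[OF stationary_unb[OF P2(1)]] by blast
    then have "Q d d'" using P2 by (auto simp: Q_def)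
    then show False using d P2(2) by blast
  qed
  then have st: "stationary (S - ?P)" using stationary_Diff S by blast
  have "\<forall>d\<in>S - ?P. \<exists>d'. Q d d'" by blast
  then obtain \<sigma> where \<sigma>: "\<And>d. d \<in> S - ?P \<Longrightarrow> Q d (\<sigma> d)" by metis
  have less: "x < d" if dx: "d \<in> S - ?P" "x \<in> set (lower_trace d (\<sigma> d))" for d x
  proof -
    have "limit_point UNIV d" using lim dx(1) by blast
    then obtain y where "y < d" unfolding limit_point_def by blast
    then show ?thesis using lower_trace_less dx(2) by blast
  qed
  obtain N where N: "stationary {d\<in>S - ?P. lower_trace d (\<sigma> d) = N}"
    using fodor_list[OF st, of "\<lambda>d. lower_trace d (\<sigma> d)"] less by blast
  let ?S' = "{d\<in>S - ?P. lower_trace d (\<sigma> d) = N}"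
  have pr: "N \<noteq> []" "\<forall>x\<in>set N. \<eta> < x" if d: "d \<in> ?S'" for d
  proof -
    have q: "Q d (\<sigma> d)" using \<sigma> d by blast
    \<comment> \<open>At an accumulation point the value would be \<open>H\<close>, which
      \<open>m'\<close> dominates.\<close>
    have "\<not> limit_point (C (\<sigma> d)) d"
    proof
      assume "limit_point (C (\<sigma> d)) d"
      then have "d \<in> accs (\<sigma> d)" using q by (simp add: accs_def Q_def)
      then have "e d (\<sigma> d) = H" using e_acc H q by (auto simp: Q_def)
      then show False using q by (simp add: Q_def m'_def)
    qed
    then show "N \<noteq> []" using d lower_trace_Nil_iff[of d "\<sigma> d"] q by (auto simp: Q_def)
    obtain x0 where "x0 \<in> C (\<sigma> d)" "\<eta> < x0" "x0 < d" using q by (auto simp: Q_def)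
    then have "\<eta> < last_below d (\<sigma> d)" using last_below_ge[of x0 "\<sigma> d" d] by simp
    then show "\<forall>x\<in>set N. \<eta> < x" using lower_trace_ge[of _ d "\<sigma> d"] d by (auto intro: order.strict_trans2)
  qed
  obtain d0 where "d0 \<in> ?S'" using stationary_unb[OF N] unfolding unbounded_def by blast
  show ?thesis
  proof (intro exI conjI)
    show "stationary ?S'" by fact
    show "?S' \<subseteq> S" by blast
    show "N \<noteq> []" "\<forall>x\<in>set N. \<eta> < x" using pr \<open>d0 \<in> ?S'\<close> by blast+
    show "\<forall>d\<in>?S'. \<sigma> d \<in> S \<and> d < \<sigma> d \<and> m < e d (\<sigma> d) \<and> lower_trace d (\<sigma> d) = N \<and> (\<forall>x\<in>set N. x < d)"
    proof
      fix d assume d: "d \<in> ?S'"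
      then have q: "Q d (\<sigma> d)" using \<sigma> by blast
      have "\<forall>x\<in>set N. x < d" using less[of d] d by blast
      then show "\<sigma> d \<in> S \<and> d < \<sigma> d \<and> m < e d (\<sigma> d) \<and> lower_trace d (\<sigma> d) = N \<and> (\<forall>x\<in>set N. x < d)"
        using d q by (simp add: Q_def m'_def)
    qed
  qed
qed

text \<open>As \<open>e d s\<close> exceeds \<open>e s b\<close>, subadditivity leaves no choice for
  \<open>e d b\<close>; the traces concatenate since \<open>N\<close> lies above
  \<open>F\<close>.\<close>

lemma raise_append:
  assumes "d < s" "s \<le> b" "lower_trace s b = F" "lower_trace d s = N" "\<forall>x\<in>set F. \<forall>y\<in>set N. x < y" "N \<noteq> []"
    "\<forall>y\<in>set N. y < d" "e s b \<le> m" "m < e d s"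
  shows "lower_trace d b = F @ N" "e d b = e d s"
proof -
  obtain y where "y \<in> set N" using assms(6) by (meson last_in_set)
  then have "\<forall>x\<in>set F. x < d" using assms(5,7) by (meson order.strict_trans)
  then show "lower_trace d b = F @ N" using lower_trace_append[OF assms(2,1)] assms(3-5) by (simp add: less_imp_le)
  have "e d b \<le> max (e d s) (e s b)" "e d s \<le> max (e d b) (e s b)"
    using e_triangle_top[of d s b] e_triangle_bottom[of d s b] assms(1,2) by auto
  then show "e d b = e d s" using assms(8,9) by linarith
qed

text \<open>
  Two raises are needed: after the first one, all values at later trace points exceed \<open>m\<close>, and the
  second one adds such points.
\<close>

lemma raise_block:
  assumes S: "stationary S" and lim: "\<And>d. d \<in> S \<Longrightarrow> limit_point UNIV d" and H: "\<And>d. d \<in> S \<Longrightarrow> h d = H"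
    and b: "\<And>d. d \<in> S \<Longrightarrow> d \<le> b d \<and> lower_trace d (b d) = F"
  shows "\<exists>S' M w \<sigma>. stationary S' \<and> S' \<subseteq> S \<and> (\<forall>x\<in>set M. \<eta> < x) \<and>
    (\<forall>d\<in>S'. \<sigma> d \<in> S \<and> d < \<sigma> d \<and> lower_trace d (b (\<sigma> d)) = F @ M \<and>
      (\<forall>x\<in>set M. x < d \<and> e x (b (\<sigma> d)) \<le> w) \<and> (\<exists>x\<in>set M. m < e x (b (\<sigma> d))))"
proof -
  obtain d0 where d0: "d0 \<in> S" using stationary_unb[OF S] unfolding unbounded_def by blast
  have F0: "\<forall>x\<in>set F. x < d0" using lower_trace_less lim[OF d0] b[OF d0] unfolding limit_point_def by blast
  obtain j where S1: "stationary {d\<in>S. e d (b d) = j}" using fodor_countable[OF S, of "\<lambda>d. e d (b d)"] by blast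
  let ?S1 = "{d\<in>S. e d (b d) = j}"
  obtain S2 N1 \<sigma>1 where S2: "stationary S2" "S2 \<subseteq> ?S1" "N1 \<noteq> []" "\<forall>x\<in>set N1. max \<eta> d0 < x"
    "\<forall>d\<in>S2. \<sigma>1 d \<in> ?S1 \<and> d < \<sigma>1 d \<and> max j m < e d (\<sigma>1 d) \<and> lower_trace d (\<sigma>1 d) = N1 \<and> (\<forall>x\<in>set N1. x < d)"
    using raise_values[OF S1, of H "max \<eta> d0" "max j m"] lim H by blast
  have b1: "lower_trace d (b (\<sigma>1 d)) = F @ N1" "m < e d (b (\<sigma>1 d))" if "d \<in> S2" for d
  proof -
    have s: "\<sigma>1 d \<in> ?S1" "d < \<sigma>1 d" "max j m < e d (\<sigma>1 d)" "lower_trace d (\<sigma>1 d) = N1" "\<forall>x\<in>set N1. x < d"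
      using S2(5) that by auto
    have lt: "\<forall>x\<in>set F. \<forall>y\<in>set N1. x < y"
    proof (intro ballI)
      fix x y assume "x \<in> set F" "y \<in> set N1"
      then have "x < d0" "d0 < y" using F0 S2(4) by auto
      then show "x < y" by simp
    qed
    have bs: "\<sigma>1 d \<le> b (\<sigma>1 d)" "lower_trace (\<sigma>1 d) (b (\<sigma>1 d)) = F" using b s(1) by auto
    have je: "e (\<sigma>1 d) (b (\<sigma>1 d)) \<le> max j m" using s(1) by simp
    note r = raise_append[OF s(2) bs s(4) lt S2(3) s(5) je s(3)]
    show "lower_trace d (b (\<sigma>1 d)) = F @ N1" by (rule r(1))
    show "m < e d (b (\<sigma>1 d))" using r(2) s(3) by simp
  qed
  \<comment> \<open>The first raise made \<open>e d (b (\<sigma>1 d))\<close> exceed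
    \<open>m\<close>; this persists on an interval below \<open>d\<close> whose lower end Fodor's
    lemma makes constant.\<close>
  have cl: "\<exists>g<d. \<forall>x. g < x \<and> x < d \<longrightarrow> m < e x (b (\<sigma>1 d))" if d: "d \<in> S2" for d
  proof -
    have "d < \<sigma>1 d" "\<sigma>1 d \<in> S" using S2(5) d by auto
    then have "d \<le> b (\<sigma>1 d)" using b[of "\<sigma>1 d"] by auto
    moreover have "limit_point UNIV d" using lim S2(2) d by blast
    then obtain y where "y < d" unfolding limit_point_def by blast
    ultimately obtain g where "g < d" "\<forall>x. g < x \<and> x < d \<longrightarrow> e x (b (\<sigma>1 d)) = max (e d (b (\<sigma>1 d))) (e x d)"
      using e_near_limit by blast
    then show ?thesis using b1(2)[OF d] by (intro exI[of _ g]) auto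
  qed
  obtain S3 l0 where S3: "stationary S3" "S3 \<subseteq> S2" "\<forall>d\<in>S3. l0 < d \<and> (\<forall>x. l0 < x \<and> x < d \<longrightarrow> m < e x (b (\<sigma>1 d)))"
    using fodor_ex[OF S2(1) cl] by blast
  obtain d1 where d1: "d1 \<in> S3" using stationary_unb[OF S3(1)] unfolding unbounded_def by blast
  obtain j1 where S4: "stationary {d\<in>S3. e d (b (\<sigma>1 d)) = j1}"
    using fodor_countable[OF S3(1), of "\<lambda>d. e d (b (\<sigma>1 d))"] by blast
  let ?S4 = "{d\<in>S3. e d (b (\<sigma>1 d)) = j1}"
  have S4S: "?S4 \<subseteq> S" using S3(2) S2(2) by blast
  \<comment> \<open>The points of \<open>N2\<close> lie above \<open>l0\<close> and below
    \<open>\<sigma>2 d\<close>, where values exceed \<open>m\<close>; \<open>d0\<close> and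
    \<open>d1\<close> keep them above \<open>F\<close> and \<open>N1\<close>.\<close>
  obtain S5 N2 \<sigma>2 where S5: "stationary S5" "S5 \<subseteq> ?S4" "N2 \<noteq> []" "\<forall>x\<in>set N2. max (max \<eta> d0) (max l0 d1) < x"
    "\<forall>d\<in>S5. \<sigma>2 d \<in> ?S4 \<and> d < \<sigma>2 d \<and> j1 < e d (\<sigma>2 d) \<and> lower_trace d (\<sigma>2 d) = N2 \<and> (\<forall>x\<in>set N2. x < d)"
    using raise_values[OF S4, of H "max (max \<eta> d0) (max l0 d1)" j1] lim H S4S by blast
  define \<sigma> where "\<sigma> d = \<sigma>1 (\<sigma>2 d)" for d
  define M where "M = N1 @ N2"
  have N1d1: "\<forall>x\<in>set N1. x < d1" using S2(5) S3(2) d1 by blast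
  have b2: "lower_trace d (b (\<sigma> d)) = F @ M" "\<forall>x\<in>set M. x < d" "\<exists>x\<in>set M. m < e x (b (\<sigma> d))" "\<sigma> d \<in> S" "d < \<sigma> d"
    if d: "d \<in> S5" for d
  proof -
    have s: "\<sigma>2 d \<in> ?S4" "d < \<sigma>2 d" "j1 < e d (\<sigma>2 d)" "lower_trace d (\<sigma>2 d) = N2" "\<forall>x\<in>set N2. x < d"
      using S5(5) d by auto
    have s2: "\<sigma>2 d \<in> S2" using s(1) S3(2) by blast
    then have s1: "\<sigma> d \<in> S" "\<sigma>2 d < \<sigma> d" using S2(5) by (auto simp: \<sigma>_def)
    show "\<sigma> d \<in> S" by fact
    show "d < \<sigma> d" using s1 s(2) by simp
    have le: "\<sigma>2 d \<le> b (\<sigma> d)" using s1 b[of "\<sigma> d"] by auto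
    have LT2: "lower_trace (\<sigma>2 d) (b (\<sigma> d)) = F @ N1" using b1(1)[OF s2] by (simp add: \<sigma>_def)
    have lt: "\<forall>x\<in>set (F @ N1). \<forall>y\<in>set N2. x < y"
    proof (intro ballI)
      fix x y assume "x \<in> set (F @ N1)" "y \<in> set N2"
      then have "x < max d0 d1" "max d0 d1 < y" using F0 N1d1 S5(4) by (auto simp: less_max_iff_disj)
      then show "x < y" by (rule order.strict_trans)
    qed
    have je: "e (\<sigma>2 d) (b (\<sigma> d)) \<le> j1" using s(1) by (simp add: \<sigma>_def)
    show lower_trace: "lower_trace d (b (\<sigma> d)) = F @ M"
      using raise_append(1)[OF s(2) le LT2 s(4) lt S5(3) s(5) je s(3)] by (simp add: M_def)
    obtain y where y: "y \<in> set N2" using S5(3) by (meson last_in_set)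
    have yb: "d1 < y" "l0 < y" "y < d" using y S5(4) s(5) by auto
    then have d1d: "d1 < d" by simp
    show "\<forall>x\<in>set M. x < d" 
    proof
      fix x assume "x \<in> set M"
      then have "x < d \<or> x < d1" using s(5) N1d1 by (auto simp: M_def)
      then show "x < d" using d1d by auto
    qed
    have "y < \<sigma>2 d" using yb(3) s(2) by simp
    then have "m < e y (b (\<sigma> d))" using S3(3) s(1) yb(2) by (auto simp: \<sigma>_def)
    then show "\<exists>x\<in>set M. m < e x (b (\<sigma> d))" using y by (auto simp: M_def)
  qed
  let ?f = "\<lambda>d. Max (insert 0 ((\<lambda>x. e x (b (\<sigma> d))) ` set M))"
  obtain w where S6: "stationary {d\<in>S5. ?f d = w}" using fodor_countable[OF S5(1), of ?f] by blast
  let ?S6 = "{d\<in>S5. ?f d = w}"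
  have w: "e x (b (\<sigma> d)) \<le> w" if "d \<in> ?S6" "x \<in> set M" for d x
  proof -
    have "e x (b (\<sigma> d)) \<le> ?f d" using that by (intro Max_ge) auto
    also have "?f d = w" using that by blast
    finally show ?thesis .
  qed
  show ?thesis
  proof (intro exI conjI)
    show "stationary ?S6" by fact
    show "?S6 \<subseteq> S" using S5(2) S4S by blast
    show "\<forall>x\<in>set M. \<eta> < x" using S2(4) S5(4) by (auto simp: M_def)
    show "\<forall>d\<in>?S6. \<sigma> d \<in> S \<and> d < \<sigma> d \<and> lower_trace d (b (\<sigma> d)) = F @ M \<and>
      (\<forall>x\<in>set M. x < d \<and> e x (b (\<sigma> d)) \<le> w) \<and> (\<exists>x\<in>set M. m < e x (b (\<sigma> d)))"
      using b2 w by blast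
  qed
qed

end

subsection \<open>A rectangular colouring with countably many colours\<close>

lemma list_bound: "\<exists>U::nat. \<forall>(u, v)\<in>set xs. u \<le> U \<and> v \<le> U"
proof (induction xs)
  case (Cons x xs)
  then obtain U where U: "\<forall>(u, v)\<in>set xs. u \<le> U \<and> v \<le> U" by blast
  show ?case using U by (intro exI[of _ "max U (max (fst x) (snd x))"]) (auto simp: le_max_iff_disj split: prod.splits)
qed simp

context nat_labelled_system
begin

lemma unbounded_greater: "unbounded (A :: 'k set) \<Longrightarrow> unbounded {a\<in>A. z < a}"
  unfolding unbounded_def
proof
  fix g assume "\<forall>g. \<exists>x\<in>A. g < x"
  then obtain x where "x \<in> A" "max z g < x" by blast
  then show "\<exists>x\<in>{a \<in> A. z < a}. g < x" by auto
qed

lemma high_unbounded: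
  assumes \<eta>: "\<forall>J \<gamma>. \<exists>a\<in>A. \<gamma> < a \<and> (\<forall>x. \<eta> \<le> x \<and> x < \<gamma> \<longrightarrow> J < e x a)"
    and M: "\<forall>x\<in>set M. \<eta> < x" "\<forall>x\<in>set M. x < z"
  shows "unbounded {a\<in>A. \<forall>x\<in>set M. x < a \<and> w < e x a}"
  unfolding unbounded_def
proof
  fix g
  obtain a where a: "a \<in> A" "max g z < a" "\<forall>x. \<eta> \<le> x \<and> x < max g z \<longrightarrow> w < e x a" using \<eta> by blast
  have "x < a \<and> w < e x a" if "x \<in> set M" for x
  proof -
    have "\<eta> \<le> x" "x < max g z" using M that by (auto simp: less_max_iff_disj)
    then show ?thesis using a(3) order.strict_trans[OF _ a(2)] by blast
  qed
  then show "\<exists>a\<in>{a\<in>A. \<forall>x\<in>set M. x < a \<and> w < e x a}. g < a" using a by auto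
qed

text \<open>The state after \<open>n\<close> extensions: \<open>bs k d\<close> is a value of
  \<open>b\<close> at some point of \<open>S0\<close> from \<open>d\<close> on, its trace
  \<open>Fs k\<close> does not depend on \<open>d\<close>, and against every
  \<open>a \<in> A\<close> that trace has chain length exactly \<open>m + k\<close>.
  \<open>U\<close> bounds all values met so far.\<close>

definition chain_state ::
  "'k set \<Rightarrow> ('k \<Rightarrow> 'k) \<Rightarrow> nat \<Rightarrow> 'k set \<Rightarrow> 'k set \<Rightarrow> nat \<Rightarrow> nat \<Rightarrow> (nat \<Rightarrow> 'k list) \<Rightarrow> (nat \<Rightarrow> 'k \<Rightarrow> 'k) \<Rightarrow> bool" where
  "chain_state S0 b n S A m U Fs bs \<longleftrightarrow> stationary S \<and> S \<subseteq> S0 \<and> unbounded A \<and>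
    (\<forall>k\<le>n. \<forall>d\<in>S. (\<exists>s\<in>S0. d \<le> s \<and> bs k d = b s) \<and> lower_trace d (bs k d) = Fs k) \<and>
    (\<forall>k\<le>n. \<forall>a\<in>A. (\<forall>x\<in>set (Fs k). x < a) \<and>
      (\<forall>d\<in>S. max_chain (value_pairs a (bs k d) (Fs k)) 0 = m + k \<and>
        (\<forall>(u, v)\<in>set (value_pairs a (bs k d) (Fs k)). u \<le> U \<and> v \<le> U)))"

text \<open>Fodor's lemma fixes the trace and the values of \<open>b d\<close> on it, a countable
  partition fixes those of \<open>a\<close>; all value pairs are then constant.\<close>

lemma chain_0:
  assumes S: "stationary S" and lim: "\<And>d. d \<in> S \<Longrightarrow> limit_point UNIV d" and A: "unbounded A"
  shows "\<exists>S' A' m U Fs bs. A' \<subseteq> A \<and> chain_state S b 0 S' A' m U Fs bs"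
proof -
  have less: "x < d" if dx: "d \<in> S" "x \<in> set (lower_trace d (b d))" for d x
  proof -
    have "limit_point UNIV d" using lim dx(1) by blast
    then obtain y where "y < d" unfolding limit_point_def by blast
    then show ?thesis using lower_trace_less dx(2) by blast
  qed
  have "\<exists>F. stationary {d\<in>S. lower_trace d (b d) = F}" by (rule fodor_list[OF S]) (rule less)
  then obtain F where S1: "stationary {d\<in>S. lower_trace d (b d) = F}" ..
  obtain gs where S2': "stationary {d\<in>{d\<in>S. lower_trace d (b d) = F}. map (\<lambda>x. e x (b d)) F = gs}"
    using fodor_countable[OF S1, of "\<lambda>d. map (\<lambda>x. e x (b d)) F"] ..
  define S2 where "S2 = {d\<in>{d\<in>S. lower_trace d (b d) = F}. map (\<lambda>x. e x (b d)) F = gs}"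
  have S2: "stationary S2" unfolding S2_def by (rule S2')
  have S2D: "d \<in> S" "lower_trace d (b d) = F" "map (\<lambda>x. e x (b d)) F = gs" if "d \<in> S2" for d
    using that by (simp_all add: S2_def)
  obtain d0 where d0: "d0 \<in> S2" using stationary_unb[OF S2] unfolding unbounded_def by blast
  have F: "x < d0" if "x \<in> set F" for x using less[of d0 x] S2D[OF d0] that by simp
  obtain fs where A2': "unbounded {a\<in>{a\<in>A. d0 < a}. map (\<lambda>x. e x a) F = fs}"
    using unbounded_countable[OF unbounded_greater[OF A, of d0], of "\<lambda>a. map (\<lambda>x. e x a) F"] ..
  define A2 where "A2 = {a\<in>{a\<in>A. d0 < a}. map (\<lambda>x. e x a) F = fs}"
  have A2: "unbounded A2" unfolding A2_def by (rule A2')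
  have A2D: "a \<in> A" "d0 < a" "map (\<lambda>x. e x a) F = fs" if "a \<in> A2" for a
    using that by (simp_all add: A2_def)
  have value_pairs: "value_pairs a (b d) F = zip fs gs" if "a \<in> A2" "d \<in> S2" for a d
    unfolding value_pairs_zip A2D(3)[OF that(1)] S2D(3)[OF that(2)] ..
  obtain U where U: "\<forall>(u, v)\<in>set (zip fs gs). u \<le> U \<and> v \<le> U" using list_bound ..
  have "chain_state S b 0 S2 A2 (max_chain (zip fs gs) 0) U (\<lambda>_. F) (\<lambda>_. b)"
    unfolding chain_state_def
  proof (intro conjI allI impI ballI)
    show "stationary S2" by fact
    show "unbounded A2" by fact
    show "S2 \<subseteq> S" using S2D(1) by blast
    fix d assume d: "d \<in> S2"
    show "\<exists>s\<in>S. d \<le> s \<and> b d = b s" using S2D(1)[OF d] by blast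
    show "lower_trace d (b d) = F" by (rule S2D(2)[OF d])
  next
    fix a x assume "a \<in> A2" "x \<in> set F"
    then show "x < a" using F[of x] A2D(2)[of a] by simp
  next
    fix k a d assume "k \<le> (0::nat)" "a \<in> A2" "d \<in> S2"
    then show "max_chain (value_pairs a (b d) F) 0 = max_chain (zip fs gs) 0 + k" using value_pairs[of a d] by simp
  next
    fix a d x assume ad: "a \<in> A2" "d \<in> S2" and x: "x \<in> set (value_pairs a (b d) F)"
    show "case x of (u, v) \<Rightarrow> u \<le> U \<and> v \<le> U" using U x unfolding value_pairs[OF ad] by (rule bspec)
  qed
  moreover have "A2 \<subseteq> A" using A2D(1) by blast
  ultimately show ?thesis by blast
qed

text \<open>The new trace is \<open>Fs n\<close> followed by a raised block \<open>M\<close>, and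
  \<open>A\<close> is thinned so that its values on \<open>M\<close> exceed those of the other side.
  The block then adds exactly one to the chain length.\<close>

lemma chain_Suc:
  assumes st: "chain_state S0 b n S A m U Fs bs"
    and lim: "\<And>d. d \<in> S0 \<Longrightarrow> limit_point UNIV d" and H: "\<And>d. d \<in> S0 \<Longrightarrow> h d = H"
    and b: "\<And>d. d \<in> S0 \<Longrightarrow> d \<le> b d"
  shows "\<exists>S' A' U' Fs' bs'. A' \<subseteq> A \<and> chain_state S0 b (Suc n) S' A' m U' Fs' bs'"
proof -
  have S: "stationary S" "S \<subseteq> S0" and A: "unbounded A"
    and bs: "\<And>k d. k \<le> n \<Longrightarrow> d \<in> S \<Longrightarrow> (\<exists>s\<in>S0. d \<le> s \<and> bs k d = b s) \<and> lower_trace d (bs k d) = Fs k"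
    and FA: "\<And>k a x. k \<le> n \<Longrightarrow> a \<in> A \<Longrightarrow> x \<in> set (Fs k) \<Longrightarrow> x < a"
    and max_chain: "\<And>k a d. k \<le> n \<Longrightarrow> a \<in> A \<Longrightarrow> d \<in> S \<Longrightarrow> max_chain (value_pairs a (bs k d) (Fs k)) 0 = m + k"
    and U: "\<And>k a d. k \<le> n \<Longrightarrow> a \<in> A \<Longrightarrow> d \<in> S \<Longrightarrow> \<forall>(u, v)\<in>set (value_pairs a (bs k d) (Fs k)). u \<le> U \<and> v \<le> U"
    using st unfolding chain_state_def by blast+
  obtain \<eta> where \<eta>: "\<forall>J \<gamma>. \<exists>a\<in>A. \<gamma> < a \<and> (\<forall>x. \<eta> \<le> x \<and> x < \<gamma> \<longrightarrow> J < e x a)" using uniformly_high_on_segment[OF A] by blast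
  have bn: "d \<le> bs n d \<and> lower_trace d (bs n d) = Fs n" if d: "d \<in> S" for d
  proof -
    obtain s where s: "s \<in> S0" "d \<le> s" "bs n d = b s" using bs[of n d] d by blast
    then have "d \<le> bs n d" using b[of s] by simp
    then show ?thesis using bs[of n d] d by blast
  qed
  have limS: "\<And>d. d \<in> S \<Longrightarrow> limit_point UNIV d" and HS: "\<And>d. d \<in> S \<Longrightarrow> h d = H" using lim H S(2) by auto
  from raise_block[OF S(1) limS HS bn, of \<eta> U]
  obtain S' M w \<sigma> where S': "stationary S'" "S' \<subseteq> S" "\<forall>x\<in>set M. \<eta> < x"
    and \<sigma>: "\<forall>d\<in>S'. \<sigma> d \<in> S \<and> d < \<sigma> d \<and> lower_trace d (bs n (\<sigma> d)) = Fs n @ M \<and>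
      (\<forall>x\<in>set M. x < d \<and> e x (bs n (\<sigma> d)) \<le> w) \<and> (\<exists>x\<in>set M. U < e x (bs n (\<sigma> d)))"
    by blast
  obtain d0 where d0: "d0 \<in> S'" using stationary_unb[OF S'(1)] unfolding unbounded_def by blast
  have M: "\<forall>x\<in>set M. x < d0" using \<sigma> d0 by blast
  let ?A1 = "{a\<in>A. \<forall>x\<in>set M. x < a \<and> w < e x a}"
  have A1: "unbounded ?A1" using high_unbounded[OF \<eta> S'(3) M] .
  obtain us where A2: "unbounded {a\<in>?A1. map (\<lambda>x. e x a) M = us}"
    using unbounded_countable[OF A1, of "\<lambda>a. map (\<lambda>x. e x a) M"] by blast
  let ?A2 = "{a\<in>?A1. map (\<lambda>x. e x a) M = us}"
  define U' where "U' = max U (max w (Max (insert 0 (set us))))"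
  have usU: "u \<le> U'" if "u \<in> set us" for u
  proof -
    have "u \<le> Max (insert 0 (set us))" using that by simp
    then show ?thesis by (simp add: U'_def)
  qed
  define bs' where "bs' k = (if k \<le> n then bs k else (\<lambda>d. bs n (\<sigma> d)))" for k
  define Fs' where "Fs' k = (if k \<le> n then Fs k else Fs n @ M)" for k
  have new: "max_chain (value_pairs a (bs n (\<sigma> d)) (Fs n @ M)) 0 = m + Suc n \<and>
      (\<forall>(u, v)\<in>set (value_pairs a (bs n (\<sigma> d)) (Fs n @ M)). u \<le> U' \<and> v \<le> U')"
    if a: "a \<in> ?A2" and d: "d \<in> S'" for a d
  proof
    let ?b = "bs n (\<sigma> d)"
    have aA: "a \<in> A" and sS: "\<sigma> d \<in> S" using a d \<sigma> by auto
    have val: "\<forall>(u, v)\<in>set (value_pairs a ?b M). v \<le> w \<and> w < u" using a d \<sigma> by (auto simp: value_pairs_def)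
    have old: "max_chain (value_pairs a ?b (Fs n)) 0 = m + n" "\<forall>(u, v)\<in>set (value_pairs a ?b (Fs n)). u \<le> U \<and> v \<le> U"
      by (rule max_chain[OF le_refl aA sS], rule U[OF le_refl aA sS])
    obtain x where x: "x \<in> set M" "U < e x ?b" using \<sigma> d by blast
    then have "(e x a, e x ?b) \<in> set (value_pairs a ?b M)" by (auto simp: value_pairs_def)
    \<comment> \<open>A point of \<open>M\<close> with value above \<open>U\<close> extends every
      chain in the old part; a second point of \<open>M\<close> is excluded by
      \<open>v \<le> w < u\<close>.\<close>
    then have "1 \<le> max_chain (value_pairs a ?b M) (Suc U)" by (rule max_chain_ge_1) (use x in simp)
    moreover have "max_chain (value_pairs a ?b (Fs n)) 0 + max_chain (value_pairs a ?b M) (Suc U) \<le> max_chain (value_pairs a ?b (Fs n) @ value_pairs a ?b M) 0"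
      by (rule max_chain_append_ge) (use old(2) in auto)
    moreover have "max_chain (value_pairs a ?b (Fs n) @ value_pairs a ?b M) 0 \<le> max_chain (value_pairs a ?b (Fs n)) 0 + max_chain (value_pairs a ?b M) 0"
      by (rule max_chain_append_le)
    moreover have "max_chain (value_pairs a ?b M) 0 \<le> 1" by (rule max_chain_le_1[OF val])
    ultimately show "max_chain (value_pairs a ?b (Fs n @ M)) 0 = m + Suc n" using old(1) by (simp add: value_pairs_append)
    have "e x a \<le> U'" if "x \<in> set M" for x using a that by (intro usU) auto
    moreover have "e x ?b \<le> U'" if "x \<in> set M" for x
    proof -
      have "e x ?b \<le> w" using \<sigma> d that by blast
      then show ?thesis by (simp add: U'_def)
    qed
    ultimately have "\<forall>(u, v)\<in>set (value_pairs a ?b M). u \<le> U' \<and> v \<le> U'" by (auto simp: value_pairs_def)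
    moreover have "\<forall>(u, v)\<in>set (value_pairs a ?b (Fs n)). u \<le> U' \<and> v \<le> U'" using old(2) by (fastforce simp: U'_def)
    ultimately show "\<forall>(u, v)\<in>set (value_pairs a ?b (Fs n @ M)). u \<le> U' \<and> v \<le> U'" by (auto simp: value_pairs_append)
  qed
  have "chain_state S0 b (Suc n) S' ?A2 m U' Fs' bs'"
    unfolding chain_state_def
  proof (intro conjI allI impI)
    show "stationary S'" by fact
    show "S' \<subseteq> S0" using S'(2) S(2) by blast
    show "unbounded ?A2" by fact
    fix k assume k: "k \<le> Suc n"
    show "\<forall>d\<in>S'. (\<exists>s\<in>S0. d \<le> s \<and> bs' k d = b s) \<and> lower_trace d (bs' k d) = Fs' k"
    proof
      fix d assume d: "d \<in> S'"
      show "(\<exists>s\<in>S0. d \<le> s \<and> bs' k d = b s) \<and> lower_trace d (bs' k d) = Fs' k"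
      proof (cases "k \<le> n")
        case True
        then show ?thesis using bs[OF True, of d] d S'(2) by (auto simp: bs'_def Fs'_def)
      next
        case False
        have s: "\<sigma> d \<in> S" "d < \<sigma> d" "lower_trace d (bs n (\<sigma> d)) = Fs n @ M" using \<sigma> d by auto
        obtain s' where s': "s' \<in> S0" "\<sigma> d \<le> s'" "bs n (\<sigma> d) = b s'" using bs[of n "\<sigma> d"] s(1) by blast
        have "d \<le> s'" using s(2) s'(2) by simp
        with s' s(3) False show ?thesis by (auto simp: bs'_def Fs'_def)
      qed
    qed
    show "\<forall>a\<in>?A2. (\<forall>x\<in>set (Fs' k). x < a) \<and> (\<forall>d\<in>S'. max_chain (value_pairs a (bs' k d) (Fs' k)) 0 = m + k \<and>
        (\<forall>(u, v)\<in>set (value_pairs a (bs' k d) (Fs' k)). u \<le> U' \<and> v \<le> U'))"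
    proof
      fix a assume a: "a \<in> ?A2"
      then have aA: "a \<in> A" by blast
      show "(\<forall>x\<in>set (Fs' k). x < a) \<and> (\<forall>d\<in>S'. max_chain (value_pairs a (bs' k d) (Fs' k)) 0 = m + k \<and>
        (\<forall>(u, v)\<in>set (value_pairs a (bs' k d) (Fs' k)). u \<le> U' \<and> v \<le> U'))"
      proof (intro conjI ballI)
        fix x assume "x \<in> set (Fs' k)"
        then show "x < a" using FA[OF _ aA] a by (auto simp: Fs'_def split: if_splits)
      next
        fix d assume d: "d \<in> S'"
        then have dS: "d \<in> S" using S'(2) by blast
        show "max_chain (value_pairs a (bs' k d) (Fs' k)) 0 = m + k"
        proof (cases "k \<le> n")
          case True
          then show ?thesis using max_chain[OF True aA dS] by (simp add: bs'_def Fs'_def)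
        next
          case False
          then have "k = Suc n" using k by simp
          then show ?thesis using new[OF a d] by (simp add: bs'_def Fs'_def)
        qed
      next
        fix d y assume d: "d \<in> S'" and y: "y \<in> set (value_pairs a (bs' k d) (Fs' k))"
        then have dS: "d \<in> S" using S'(2) by blast
        show "case y of (u, v) \<Rightarrow> u \<le> U' \<and> v \<le> U'"
        proof (cases "k \<le> n")
          case True
          then have "case y of (u, v) \<Rightarrow> u \<le> U \<and> v \<le> U"
            using U[OF True aA dS] y by (simp add: bs'_def Fs'_def)
          then show ?thesis by (auto simp: U'_def)
        next
          case False
          then show ?thesis using new[OF a d] y by (simp add: bs'_def Fs'_def)
        qed
      qed
    qed
  qed
  moreover have "?A2 \<subseteq> A" by blast
  ultimately show ?thesis by blast
qed

lemma chain:
  assumes S: "stationary S" and lim: "\<And>d. d \<in> S \<Longrightarrow> limit_point UNIV d" and H: "\<And>d. d \<in> S \<Longrightarrow> h d = H"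
    and b: "\<And>d. d \<in> S \<Longrightarrow> d \<le> b d" and A: "unbounded A"
  shows "\<exists>S' A' m U Fs bs. A' \<subseteq> A \<and> chain_state S b n S' A' m U Fs bs"
proof (induction n)
  case 0
  show ?case using chain_0[OF S lim A] by blast
next
  case (Suc n)
  then obtain S' A' m U Fs bs where 1: "A' \<subseteq> A" "chain_state S b n S' A' m U Fs bs" by blast
  obtain S'' A'' U' Fs' bs' where "A'' \<subseteq> A'" "chain_state S b (Suc n) S'' A'' m U' Fs' bs'"
    using chain_Suc[OF 1(2) lim H b] by blast
  with 1(1) show ?case by blast
qed

text \<open>
  After the chain is built, one more common raise \<open>N\<close> makes \<open>e(_, bs k (\<sigma> d))\<close> independent of \<open>k\<close> just below \<open>d\<close>
  and larger there than every earlier value. Hence the traces continue below \<open>d\<close> with the same pairs of values, and the chains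
  before and after \<open>N\<close> can be concatenated, while \<open>N\<close> itself contributes at most one element.
\<close>

lemma trace_colour_hits:
  assumes S0: "stationary S0" and lim0: "\<And>d. d \<in> S0 \<Longrightarrow> limit_point UNIV d"
    and b0: "\<And>d. d \<in> S0 \<Longrightarrow> d \<le> b d" and A0: "unbounded A0"
  shows "\<exists>s\<in>S0. \<exists>a\<in>A0. a < s \<and> trace_colour a (b s) = v"
proof -
  obtain H where S1: "stationary {d\<in>S0. h d = H}" using fodor_countable[OF S0, of h] by blast
  let ?S1 = "{d\<in>S0. h d = H}"
  \<comment> \<open>Large enough for the window in \<open>ruler_hit\<close>.\<close>
  define n :: nat where "n = 2 ^ (v + 3)"
  obtain S A m U Fs bs where AA: "A \<subseteq> A0" and st: "chain_state ?S1 b n S A m U Fs bs"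
  proof -
    have "\<exists>S' A' m U Fs bs. A' \<subseteq> A0 \<and> chain_state ?S1 b n S' A' m U Fs bs"
      by (rule chain[OF S1 _ _ _ A0]) (use lim0 b0 in auto)
    then show ?thesis using that by blast
  qed
  have S: "stationary S" "S \<subseteq> ?S1" and A: "unbounded A"
    and bs: "\<And>k d. k \<le> n \<Longrightarrow> d \<in> S \<Longrightarrow> (\<exists>s\<in>?S1. d \<le> s \<and> bs k d = b s) \<and> lower_trace d (bs k d) = Fs k"
    and FA: "\<And>k a x. k \<le> n \<Longrightarrow> a \<in> A \<Longrightarrow> x \<in> set (Fs k) \<Longrightarrow> x < a"
    and max_chain: "\<And>k a d. k \<le> n \<Longrightarrow> a \<in> A \<Longrightarrow> d \<in> S \<Longrightarrow> max_chain (value_pairs a (bs k d) (Fs k)) 0 = m + k"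
    and U: "\<And>k a d. k \<le> n \<Longrightarrow> a \<in> A \<Longrightarrow> d \<in> S \<Longrightarrow> \<forall>(u, v)\<in>set (value_pairs a (bs k d) (Fs k)). u \<le> U \<and> v \<le> U"
    using st unfolding chain_state_def by blast+
  have lim: "limit_point UNIV d" if "d \<in> S" for d using lim0 S(2) that by blast
  have hH: "h d = H" if "d \<in> S" for d using S(2) that by blast
  have bge: "d \<le> bs k d" if k: "k \<le> n" and d: "d \<in> S" for k d
  proof -
    obtain s where s: "s \<in> ?S1" "d \<le> s" "bs k d = b s" using bs[OF k d] by blast
    then show ?thesis using b0[of s] by auto
  qed
  \<comment> \<open>A bound uniform in \<open>k\<close>, so that a single raise above it serves all
    \<open>bs k\<close> together.\<close>
  let ?f = "\<lambda>d. Max ((\<lambda>k. e d (bs k d)) ` {..n})"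
  obtain j where S2: "stationary {d\<in>S. ?f d = j}" using fodor_countable[OF S(1), of ?f] by blast
  let ?S2 = "{d\<in>S. ?f d = j}"
  have j: "e d (bs k d) \<le> j" if d: "d \<in> ?S2" and k: "k \<le> n" for d k
  proof -
    have "e d (bs k d) \<le> ?f d" using k by (intro Max_ge) auto
    also have "?f d = j" using d by blast
    finally show ?thesis .
  qed
  obtain d0 where d0: "d0 \<in> ?S2" using stationary_unb[OF S2] unfolding unbounded_def by blast
  have F0: "x < d0" if k: "k \<le> n" and x: "x \<in> set (Fs k)" for k x
  proof -
    have "limit_point UNIV d0" "lower_trace d0 (bs k d0) = Fs k" using lim d0 bs[OF k, of d0] by auto
    moreover then obtain y where "y < d0" unfolding limit_point_def by blast
    ultimately show ?thesis using lower_trace_less[of y d0 x "bs k d0"] x by simp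
  qed
  obtain \<eta> where \<eta>: "\<forall>J \<gamma>. \<exists>a\<in>A. \<gamma> < a \<and> (\<forall>x. \<eta> \<le> x \<and> x < \<gamma> \<longrightarrow> J < e x a)" using uniformly_high_on_segment[OF A] by blast
  obtain S3 N \<sigma> where S3: "stationary S3" "S3 \<subseteq> ?S2" "N \<noteq> []" "\<forall>x\<in>set N. max \<eta> d0 < x"
    and \<sigma>: "\<forall>d\<in>S3. \<sigma> d \<in> ?S2 \<and> d < \<sigma> d \<and> max j U < e d (\<sigma> d) \<and> lower_trace d (\<sigma> d) = N \<and> (\<forall>x\<in>set N. x < d)"
  proof -
    have "\<exists>S' N \<sigma>. stationary S' \<and> S' \<subseteq> ?S2 \<and> N \<noteq> [] \<and> (\<forall>x\<in>set N. max \<eta> d0 < x) \<and>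
      (\<forall>d\<in>S'. \<sigma> d \<in> ?S2 \<and> d < \<sigma> d \<and> max j U < e d (\<sigma> d) \<and> lower_trace d (\<sigma> d) = N \<and> (\<forall>x\<in>set N. x < d))"
      by (rule raise_values[where H = H, OF S2]) (use lim hH in blast)+
    then show ?thesis using that by blast
  qed
  have N0: "\<forall>x\<in>set N. \<eta> < x" "\<forall>x\<in>set N. d0 < x" using S3(4) by auto
  have rb: "lower_trace d (bs k (\<sigma> d)) = Fs k @ N" "e d (bs k (\<sigma> d)) = e d (\<sigma> d)" "d < bs k (\<sigma> d)"
    if d: "d \<in> S3" and k: "k \<le> n" for d k
  proof -
    have s: "\<sigma> d \<in> ?S2" "d < \<sigma> d" "max j U < e d (\<sigma> d)" "lower_trace d (\<sigma> d) = N" "\<forall>x\<in>set N. x < d" using \<sigma> d by auto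
    then have sS: "\<sigma> d \<in> S" by blast
    have lt: "\<forall>x\<in>set (Fs k). \<forall>y\<in>set N. x < y"
    proof (intro ballI)
      fix x y assume "x \<in> set (Fs k)" "y \<in> set N"
      then have "x < d0" "d0 < y" using F0[OF k] N0 by auto
      then show "x < y" by simp
    qed
    have jU: "e (\<sigma> d) (bs k (\<sigma> d)) \<le> max j U" using j[OF s(1) k] by simp
    have LTk: "lower_trace (\<sigma> d) (bs k (\<sigma> d)) = Fs k" using bs[OF k sS] by blast
    note r = raise_append[OF s(2) bge[OF k sS] LTk s(4) lt S3(3) s(5) jU s(3)]
    show "lower_trace d (bs k (\<sigma> d)) = Fs k @ N" "e d (bs k (\<sigma> d)) = e d (\<sigma> d)" using r by auto
    show "d < bs k (\<sigma> d)" using s(2) bge[OF k sS] by simp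
  qed
  let ?g = "\<lambda>d. Max ((\<lambda>(k, x). e x (bs k (\<sigma> d))) ` ({..n} \<times> set N))"
  obtain w where S4: "stationary {d\<in>S3. ?g d = w}" using fodor_countable[OF S3(1), of ?g] by blast
  let ?S4 = "{d\<in>S3. ?g d = w}"
  have w: "e x (bs k (\<sigma> d)) \<le> w" if d: "d \<in> ?S4" and k: "k \<le> n" and x: "x \<in> set N" for d k x
  proof -
    have "e x (bs k (\<sigma> d)) \<le> ?g d" using k x by (intro Max_ge) auto
    also have "?g d = w" using d by blast
    finally show ?thesis .
  qed
  obtain d1 where d1: "d1 \<in> ?S4" using stationary_unb[OF S4] unfolding unbounded_def by blast
  have Nd1: "\<forall>x\<in>set N. x < d1" using \<sigma> d1 by blast
  \<comment> \<open>On \<open>N\<close> the values at \<open>a\<close> exceed \<open>w\<close>,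
    which bounds the values on the other side; hence \<open>max_chain_le_1\<close> applies to
    \<open>N\<close>.\<close>
  let ?A2 = "{a\<in>A. \<forall>x\<in>set N. x < a \<and> w < e x a}"
  have A2: "unbounded ?A2" using high_unbounded[OF \<eta> N0(1) Nd1] .
  \<comment> \<open>\<open>\<zeta>\<close> is taken above \<open>N\<close> and the finitely many
    thresholds from \<open>e_near_limit\<close>. As \<open>\<zeta> \<in> C d\<close>, for
    \<open>\<zeta> < a < d\<close> the whole trace from \<open>d\<close> to \<open>a\<close> stays
    at or above \<open>\<zeta>\<close>.\<close>
  have "\<exists>\<zeta><d. \<zeta> \<in> C d \<and> (\<forall>x\<in>set N. x < \<zeta>) \<and>
      (\<forall>k\<le>n. \<forall>x. \<zeta> \<le> x \<and> x < d \<longrightarrow> e x (bs k (\<sigma> d)) = max (e d (\<sigma> d)) (e x d))" if d: "d \<in> ?S4" for d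
  proof -
    have dS3: "d \<in> S3" and dl: "limit_point UNIV d" using d S3(2) lim by auto
    obtain y where y: "y < d" using dl unfolding limit_point_def by blast
    have "\<forall>k\<in>{..n}. \<exists>g<d. \<forall>x. g < x \<and> x < d \<longrightarrow> e x (bs k (\<sigma> d)) = max (e d (bs k (\<sigma> d))) (e x d)"
      using e_near_limit[OF y] rb(3)[OF dS3] by (meson atMost_iff less_imp_le)
    then obtain g where g: "\<forall>k\<in>{..n}. g k < d \<and> (\<forall>x. g k < x \<and> x < d \<longrightarrow> e x (bs k (\<sigma> d)) = max (e d (bs k (\<sigma> d))) (e x d))"
      by metis
    let ?G = "insert y (g ` {..n} \<union> set N)"
    have fin: "finite ?G" "?G \<noteq> {}" by auto
    have "\<forall>x\<in>?G. x < d" using y g \<sigma> dS3 by auto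
    then have "Max ?G < d" using fin by (meson Max_in)
    then obtain \<zeta> where \<zeta>: "\<zeta> \<in> C d" "Max ?G < \<zeta>" "\<zeta> < d" using limit_point_C[OF dl] unfolding limit_point_def by blast
    have G: "z < \<zeta>" if "z \<in> ?G" for z by (rule le_less_trans[OF Max_ge[OF fin(1) that] \<zeta>(2)])
    show ?thesis
    proof (intro exI conjI allI impI ballI)
      show "\<zeta> < d" "\<zeta> \<in> C d" by fact+
      show "x < \<zeta>" if "x \<in> set N" for x using G that by blast
      fix k x assume k: "k \<le> n" and x: "\<zeta> \<le> x \<and> x < d"
      have "g k < \<zeta>" using G k by blast
      then have "g k < x \<and> x < d" using x by auto
      then have "e x (bs k (\<sigma> d)) = max (e d (bs k (\<sigma> d))) (e x d)" using g k by blast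
      then show "e x (bs k (\<sigma> d)) = max (e d (\<sigma> d)) (e x d)" using rb(2)[OF dS3 k] by simp
    qed
  qed
  from fodor_ex[OF S4 this]
  obtain S5 \<zeta> where S5: "stationary S5" "S5 \<subseteq> ?S4" and \<zeta>: "\<forall>d\<in>S5. \<zeta> < d \<and> \<zeta> \<in> C d \<and> (\<forall>x\<in>set N. x < \<zeta>) \<and>
      (\<forall>k\<le>n. \<forall>x. \<zeta> \<le> x \<and> x < d \<longrightarrow> e x (bs k (\<sigma> d)) = max (e d (\<sigma> d)) (e x d))" by blast
  obtain a where a: "a \<in> ?A2" "\<zeta> < a" using A2 unfolding unbounded_def by blast
  obtain d where d: "d \<in> S5" "a < d" using stationary_unb[OF S5(1)] unfolding unbounded_def by blast
  have aA: "a \<in> A" using a by blast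
  have dS4: "d \<in> ?S4" using S5(2) d by blast
  then have dS3: "d \<in> S3" by blast
  have s: "\<sigma> d \<in> S" "d < \<sigma> d" "max j U < e d (\<sigma> d)" using \<sigma> dS3 by auto
  have \<zeta>d: "\<zeta> \<in> C d" "\<forall>x\<in>set N. x < \<zeta>"
    "\<And>k x. k \<le> n \<Longrightarrow> \<zeta> \<le> x \<Longrightarrow> x < d \<Longrightarrow> e x (bs k (\<sigma> d)) = max (e d (\<sigma> d)) (e x d)" using \<zeta> d(1) by auto
  let ?T = "lower_trace a d"
  have T: "\<zeta> \<le> x" "x < a" if x: "x \<in> set ?T" for x
  proof -
    have "\<zeta> \<le> last_below a d" using last_below_ge[OF \<zeta>d(1) a(2)] .
    also have "\<dots> \<le> x" using lower_trace_ge[OF x] .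
    finally show "\<zeta> \<le> x" .
    show "x < a" using lower_trace_less[OF a(2) x] .
  qed
  \<comment> \<open>The value pairs on the remaining trace, with no dependence on
    \<open>k\<close>.\<close>
  define tl where "tl = map (\<lambda>x. (e x a, max (e d (\<sigma> d)) (e x d))) ?T"
  define l where "l = m + max_chain tl 0"
  have main: "max_chain (value_pairs a (bs k (\<sigma> d)) (lower_trace a (bs k (\<sigma> d)))) 0 \<in> {l + k, l + k + 1}" if k: "k \<le> n" for k
  proof -
    let ?b = "bs k (\<sigma> d)"
    have LTd: "lower_trace d ?b = Fs k @ N" using rb(1)[OF dS3 k] .
    have less: "\<forall>x\<in>set (lower_trace d ?b). x < a" using FA[OF k aA] a(1) LTd by auto
    have le: "\<forall>x\<in>set (lower_trace d ?b). \<forall>y\<in>set ?T. x \<le> y"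
    proof (intro ballI)
      fix x y assume x: "x \<in> set (lower_trace d ?b)" and y: "y \<in> set ?T"
      obtain z where z: "z \<in> set N" using S3(3) by (meson last_in_set)
      have "x < \<zeta>"
      proof (cases "x \<in> set N")
        case False
        then have "x < d0" using x LTd F0[OF k] by simp
        also have "d0 < z" using N0 z by blast
        also have "z < \<zeta>" using \<zeta>d(2) z by blast
        finally show ?thesis .
      qed (use \<zeta>d(2) in blast)
      then show "x \<le> y" using T(1)[OF y] by simp
    qed
    have LTa: "lower_trace a ?b = (Fs k @ N) @ ?T"
      using lower_trace_append[OF less_imp_le[OF rb(3)[OF dS3 k]] d(2) less le] LTd by simp
    have tl: "value_pairs a ?b ?T = tl" unfolding value_pairs_def tl_def
    proof (rule map_cong[OF refl])
      fix x assume x: "x \<in> set ?T"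
      have "x < d" using T(2)[OF x] d(2) by simp
      then show "(e x a, e x ?b) = (e x a, max (e d (\<sigma> d)) (e x d))" using \<zeta>d(3)[OF k T(1)[OF x]] by simp
    qed
    have eq: "value_pairs a ?b (lower_trace a ?b) = value_pairs a ?b (Fs k) @ (value_pairs a ?b N @ tl)" by (simp add: LTa value_pairs_append tl)
    have N1: "max_chain (value_pairs a ?b N) 0 \<le> 1"
      by (rule max_chain_le_1[of _ w]) (use w[OF dS4 k] a(1) in \<open>auto simp: value_pairs_def\<close>)
    have Fk: "max_chain (value_pairs a ?b (Fs k)) 0 = m + k" using max_chain[OF k aA s(1)] .
    have up: "max_chain (value_pairs a ?b (lower_trace a ?b)) 0 \<le> m + k + 1 + max_chain tl 0"
      using max_chain_append_le[of "value_pairs a ?b (Fs k)" "value_pairs a ?b N @ tl" 0] max_chain_append_le[of "value_pairs a ?b N" tl 0] N1 Fk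
      unfolding eq by linarith
    \<comment> \<open>All second components in \<open>tl\<close> are at least
      \<open>e d (\<sigma> d) > U\<close>, so chains in \<open>tl\<close> may follow those in
      \<open>Fs k\<close>, skipping \<open>N\<close>.\<close>
    have "max_chain tl (Suc U) = max_chain tl 0"
      by (rule max_chain_ge_threshold) (use s(3) in \<open>auto simp: tl_def le_max_iff_disj\<close>)
    moreover have "max_chain tl (Suc U) \<le> max_chain (value_pairs a ?b N @ tl) (Suc U)" by (rule max_chain_append_skip)
    moreover have "max_chain (value_pairs a ?b (Fs k)) 0 + max_chain (value_pairs a ?b N @ tl) (Suc U) \<le> max_chain (value_pairs a ?b (lower_trace a ?b)) 0"
      unfolding eq by (rule max_chain_append_ge) (use U[OF k aA s(1)] in auto)
    ultimately have "m + k + max_chain tl 0 \<le> max_chain (value_pairs a ?b (lower_trace a ?b)) 0" using Fk by linarith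
    then show ?thesis using up by (auto simp: l_def)
  qed
  obtain k where k: "k \<le> n" "\<forall>c. c = l + k \<or> c = l + k + 1 \<longrightarrow> ruler c = v"
    using ruler_hit[of v l] unfolding n_def by blast
  have hit: "trace_colour a (bs k (\<sigma> d)) = v" unfolding trace_colour_def using k(2) main[OF k(1)] by blast
  obtain s' where s': "s' \<in> ?S1" "\<sigma> d \<le> s'" "bs k (\<sigma> d) = b s'" using bs[OF k(1) s(1)] by blast
  have "a < s'" using d(2) s(2) s'(2) by simp
  then show ?thesis using hit s' AA aA by auto
qed

end

subsection \<open>The theorem\<close>

text \<open>Choose a counterexample \<open>b \<delta>\<close> for every \<open>\<delta>\<close>. The
  requirement on \<open>e\<close> is first secured on whole intervals, so that it places no
  constraint on the \<open>a\<close> later found by \<open>trace_colour_hits\<close>.\<close>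

lemma (in nat_labelled_system) simultaneous_hit:
  fixes ht :: "'k \<Rightarrow> 't::wellorder" and hx :: "'k \<Rightarrow> 'x"
  assumes T: "labelled_system C ht" and hx: "coherent_label C hx" and A: "unbounded A"
  shows "\<exists>\<delta>. \<forall>\<beta>\<ge>\<delta>. \<exists>\<alpha>\<in>A. \<alpha> < \<delta> \<and> hx (walk \<alpha> \<beta> ! trace_colour \<alpha> \<beta>) = \<xi> \<and> i < labelled_system.e C ht \<alpha> \<beta>"
proof (rule ccontr)
  interpret T: labelled_system K C ht by (rule T)
  assume no: "\<not> ?thesis"
  have "\<forall>\<delta>. \<exists>\<beta>. \<delta> \<le> \<beta> \<and> (\<forall>\<alpha>\<in>A. \<alpha> < \<delta> \<longrightarrow> \<not> (hx (walk \<alpha> \<beta> ! trace_colour \<alpha> \<beta>) = \<xi> \<and> i < T.e \<alpha> \<beta>))"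
    using no by blast
  then obtain b where b: "\<And>\<delta>. \<delta> \<le> b \<delta>"
    and bad: "\<And>\<delta> \<alpha>. \<alpha> \<in> A \<Longrightarrow> \<alpha> < \<delta> \<Longrightarrow> \<not> (hx (walk \<alpha> (b \<delta>) ! trace_colour \<alpha> (b \<delta>)) = \<xi> \<and> i < T.e \<alpha> (b \<delta>))" by metis
  \<comment> \<open>If \<open>d < d'\<close> in a club satisfy \<open>i < T.e d d'\<close>, then by
    subadditivity \<open>d\<close> or \<open>d'\<close> has value above \<open>i\<close> at
    \<open>b d'\<close>; so \<open>L\<close> meets every club.\<close>
  define L where "L = {d. limit_point UNIV d \<and> (\<exists>s. d \<le> s \<and> i < T.e d (b s))}"
  have L: "stationary L" unfolding stationary_def
  proof (intro allI impI, rule ccontr)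
    fix E :: "'k set" assume E: "club E" and none: "\<not> (\<exists>x\<in>L. x \<in> E)"
    have "unbounded (E \<inter> {d. limit_point UNIV d})" using club_Int[OF E club_limits] by (simp add: club_def unbounded_def)
    then obtain d d' where d: "d \<in> E" "limit_point UNIV d" "d' \<in> E" "limit_point UNIV d'" "d < d'" "i < T.e d d'"
      using T.e_unbounded[of _ i] by blast
    have "T.e d (b d') \<le> i" "T.e d' (b d') \<le> i"
      using none d by (auto simp: L_def not_less intro: less_imp_le)
    moreover have "T.e d d' \<le> max (T.e d (b d')) (T.e d' (b d'))"
      using T.e_triangle_bottom[of d d' "b d'"] d(5) b by simp
    ultimately have "T.e d d' \<le> i" by (meson max.bounded_iff order_trans)
    then show False using d(6) by simp
  qed
  have "\<forall>d\<in>L. \<exists>s. d \<le> s \<and> i < T.e d (b s)" by (simp add: L_def)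
  then obtain \<sigma> where \<sigma>: "\<And>d. d \<in> L \<Longrightarrow> d \<le> \<sigma> d \<and> i < T.e d (b (\<sigma> d))" by metis
  have "\<exists>g<d. \<forall>x. g < x \<and> x < d \<longrightarrow> i < T.e x (b (\<sigma> d))" if d: "d \<in> L" for d
  proof -
    have "d \<noteq> b (\<sigma> d)" using \<sigma>[OF d] T.ebot_le[of i] by (metis T.e_refl leD)
    moreover have "d \<le> b (\<sigma> d)" using \<sigma>[OF d] b order_trans by blast
    ultimately have lt: "d < b (\<sigma> d)" by simp
    then have "\<not> limit_point {a. a < b (\<sigma> d) \<and> T.e a (b (\<sigma> d)) \<le> i} d" using T.e_closed \<sigma>[OF d] leD by blast
    moreover obtain y where "y < d" using d unfolding L_def limit_point_def by blast
    ultimately obtain g where g: "g < d" "\<forall>x\<in>{a. a < b (\<sigma> d) \<and> T.e a (b (\<sigma> d)) \<le> i}. x < d \<longrightarrow> x \<le> g"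
      using non_limit_point_bound by blast
    have "i < T.e x (b (\<sigma> d))" if x: "g < x" "x < d" for x
    proof (rule ccontr)
      assume "\<not> i < T.e x (b (\<sigma> d))"
      then have "x \<in> {a. a < b (\<sigma> d) \<and> T.e a (b (\<sigma> d)) \<le> i}" using x lt by auto
      then show False using g(2) x by auto
    qed
    then show ?thesis using g(1) by blast
  qed
  from fodor_ex[OF L this] obtain S1 g where S1: "stationary S1" "S1 \<subseteq> L"
    and g: "\<forall>d\<in>S1. g < d \<and> (\<forall>x. g < x \<and> x < d \<longrightarrow> i < T.e x (b (\<sigma> d)))" by blast
  \<comment> \<open>Between \<open>g\<close> and \<open>\<rho> d\<close> all values at
    \<open>b2 d\<close> exceed \<open>i\<close>; as \<open>d < \<rho> d\<close>, this covers every
    \<open>a\<close> with \<open>g < a < d\<close>.\<close>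
  obtain \<rho> where \<rho>: "\<And>d. \<rho> d \<in> S1 \<and> d < \<rho> d" using stationary_unb[OF S1(1)] unfolding unbounded_def by metis
  define b2 where "b2 d = b (\<sigma> (\<rho> d))" for d
  have \<rho>\<sigma>: "d < \<sigma> (\<rho> d)" for d using \<rho>[of d] \<sigma>[of "\<rho> d"] S1(2) by (meson less_le_trans subsetD)
  have b2: "d < b2 d" for d using \<rho>\<sigma>[of d] b[of "\<sigma> (\<rho> d)"] by (simp add: b2_def)
  define X where "X = {d. limit_point UNIV d \<and> hx d = \<xi>}"
  have X: "stationary X" using hx by (simp add: coherent_label_def X_def)
  have less: "x < d" if "d \<in> X" and x: "x \<in> set (lower_trace d (b2 d))" for d x
  proof -
    obtain y where "y < d" using \<open>d \<in> X\<close> unfolding X_def limit_point_def by blast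
    then show ?thesis using lower_trace_less x by blast
  qed
  have "\<exists>F. stationary {d\<in>X. lower_trace d (b2 d) = F}" by (rule fodor_list[OF X]) (rule less)
  then obtain F where S2: "stationary {d\<in>X. lower_trace d (b2 d) = F}" ..
  let ?S2 = "{d\<in>X. lower_trace d (b2 d) = F}"
  obtain d0 where d0: "d0 \<in> ?S2" using stationary_unb[OF S2] unfolding unbounded_def by blast
  have F: "\<forall>x\<in>set F. x < d0" using less d0 by blast
  have "unbounded {a\<in>A. max g d0 < a}" using unbounded_greater[OF A] .
  \<comment> \<open>\<open>length F\<close> is the number of steps after which the walk from
    \<open>b2 s\<close> stands at \<open>walk_end s (b2 s)\<close>, whose label is that of
    \<open>s\<close>, namely \<open>\<xi>\<close>.\<close>
  then have "\<exists>s\<in>?S2. \<exists>a\<in>{a\<in>A. max g d0 < a}. a < s \<and> trace_colour a (b2 s) = length F"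
    by (rule trace_colour_hits[OF S2, rotated 2]) (auto simp: X_def intro: less_imp_le b2)
  then obtain s a where s: "s \<in> ?S2" and a: "a \<in> A" "max g d0 < a" "a < s" "trace_colour a (b2 s) = length F" by blast
  have LTs: "lower_trace s (b2 s) = F" using s by blast
  have "\<forall>x\<in>set (lower_trace s (b2 s)). x < a" unfolding LTs using F a(2) by auto
  from walk_nth[OF less_imp_le[OF b2] a(3) this] have "walk a (b2 s) ! trace_colour a (b2 s) = walk_end s (b2 s)"
    using LTs a(4) by simp
  moreover have "hx (walk_end s (b2 s)) = hx s"
    by (rule walk_end_label[OF less_imp_le[OF b2]]) (use hx in \<open>auto simp: coherent_label_def\<close>)
  moreover have "hx s = \<xi>" using s by (simp add: X_def)
  moreover have "i < T.e a (b2 s)"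
  proof -
    have "g < a" "a < \<rho> s" using a \<rho>[of s] by auto
    then show ?thesis using g \<rho>[of s] unfolding b2_def by blast
  qed
  \<comment> \<open>\<open>b2 s\<close> is the counterexample chosen for
    \<open>\<delta> = \<sigma> (\<rho> s)\<close>, so \<open>a\<close> has to lie below that
    ordinal.\<close>
  moreover have "a < \<sigma> (\<rho> s)" using a(3) \<rho>\<sigma>[of s] by simp
  ultimately show False using bad[OF a(1), of "\<sigma> (\<rho> s)"] by (simp add: b2_def)
qed

section \<open>From cardinal order relations to bounds in the well-order\<close>

lemma order_of_Field: "Field (order_of TYPE('k::wellorder)) = (UNIV :: 'k set)"
  by (auto simp: Field_def order_of_def)

lemma card_UNIV_ordIso:
  assumes "infinite_regular_cardinal (order_of TYPE('k::wellorder))"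
  shows "|UNIV :: 'k set| =o order_of TYPE('k)"
  using card_of_Field_ordIso[of "order_of TYPE('k)"] assms
  by (simp add: infinite_regular_cardinal_def order_of_Field)

lemma no_max:
  assumes "infinite_regular_cardinal (order_of TYPE('k::wellorder))"
  shows "\<exists>b. (a::'k) < b"
proof -
  have "\<exists>b\<in>Field (order_of TYPE('k)). a \<noteq> b \<and> (a, b) \<in> order_of TYPE('k)"
    using assms by (intro infinite_Card_order_limit) (simp_all add: infinite_regular_cardinal_def order_of_Field)
  then show ?thesis by (auto simp: order_of_def less_le)
qed

lemma regular_bound:
  fixes f :: "'x \<Rightarrow> 'k::wellorder"
  assumes r: "infinite_regular_cardinal (order_of TYPE('k))" and X: "|X| <o order_of TYPE('k)"
  shows "\<exists>b. \<forall>x\<in>X. f x < b"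
proof -
  let ?r = "order_of TYPE('k)"
  have "|f ` X| <o ?r" by (rule ordLeq_ordLess_trans[OF card_of_image X])
  then have "\<not> |f ` X| =o ?r" by (rule not_ordLess_ordIso)
  moreover have "\<forall>Y. cofinal Y ?r \<longrightarrow> |Y| =o ?r"
    using r by (simp add: infinite_regular_cardinal_def regularCard_def order_of_Field)
  ultimately have "\<not> cofinal (f ` X) ?r" by blast
  then obtain a where a: "\<forall>y\<in>f ` X. a = y \<or> (a, y) \<notin> ?r" by (auto simp: cofinal_def)
  obtain b where "a < b" using no_max[OF r] by blast
  moreover have "f x \<le> a" if "x \<in> X" for x
    using a that by (auto simp: order_of_def)
  ultimately show ?thesis by (intro exI[of _ b] ballI) (rule order.strict_trans1)
qed

lemma card_atMost:
  assumes "infinite_regular_cardinal (order_of TYPE('k::wellorder))"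
  shows "|{..a::'k}| <o order_of TYPE('k)"
proof -
  obtain b where b: "a < b" using no_max[OF assms] by blast
  have "{..a} \<subseteq> underS (order_of TYPE('k)) b"
    using b by (auto simp: underS_def order_of_def)
  moreover have "|underS (order_of TYPE('k)) b| <o order_of TYPE('k)"
    using card_of_underS[of "order_of TYPE('k)" b] assms
    by (simp add: infinite_regular_cardinal_def order_of_Field)
  ultimately show ?thesis using ordLeq_ordLess_trans[OF card_of_mono1] by blast
qed

lemma unbounded_of_card:
  assumes "infinite_regular_cardinal (order_of TYPE('k::wellorder))" "|A| =o order_of TYPE('k)"
  shows "unbounded (A :: 'k set)"
proof (rule ccontr)
  assume "\<not> unbounded A"
  then obtain g where "\<forall>x\<in>A. \<not> g < x" unfolding unbounded_def by blast
  then have "A \<subseteq> {..g}" by (auto simp: not_less)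
  then have "|A| <o order_of TYPE('k)"
    by (rule ordLeq_ordLess_trans[OF card_of_mono1 card_atMost[OF assms(1)]])
  from not_ordLess_ordIso[OF this] show False using assms(2) by (rule notE)
qed

lemma card_of_unbounded:
  assumes "infinite_regular_cardinal (order_of TYPE('k::wellorder))" "unbounded (A :: 'k set)"
  shows "|A| =o order_of TYPE('k)"
proof -
  have "cofinal A (order_of TYPE('k))"
    unfolding cofinal_def
  proof
    fix a :: 'k
    obtain b where "b \<in> A" "a < b" using assms(2) unfolding unbounded_def by blast
    then show "\<exists>b\<in>A. a \<noteq> b \<and> (a, b) \<in> order_of TYPE('k)" by (auto simp: order_of_def)
  qed
  then show ?thesis using assms(1) by (simp add: infinite_regular_cardinal_def regularCard_def order_of_Field)
qed

text \<open>The values of \<open>m\<close> with stationary fibres have full cardinality and so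
  receive an injection of \<open>'x\<close>; its inverse, composed with \<open>m\<close>, keeps
  constancy and stationary fibres.\<close>

lemma ex_coherent_label:
  fixes C :: "'k::wellorder \<Rightarrow> 'k set"
  assumes r: "infinite_regular_cardinal (order_of TYPE('k))"
    and m: "\<And>b g. limit_point (C b) g \<Longrightarrow> g < b \<Longrightarrow> m g = m b"
    and Z: "unbounded {z::'k. stationary {d. limit_point UNIV d \<and> m d = z}}"
    and X: "|UNIV :: 'x set| \<le>o order_of TYPE('k)"
  shows "\<exists>h :: 'k \<Rightarrow> 'x. coherent_label C h"
proof -
  let ?Z = "{z::'k. stationary {d. limit_point UNIV d \<and> m d = z}}"
  have "|UNIV :: 'x set| \<le>o |?Z|"
    by (rule ordLeq_ordIso_trans[OF X ordIso_symmetric[OF card_of_unbounded[OF r Z]]])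
  then obtain i :: "'x \<Rightarrow> 'k" where i: "inj i" "range i \<subseteq> ?Z"
    unfolding card_of_ordLeq[symmetric] by blast
  have "coherent_label C (\<lambda>d. inv i (m d))" unfolding coherent_label_def
  proof (intro conjI allI impI)
    fix b g assume "limit_point (C b) g \<and> g < b"
    then show "inv i (m g) = inv i (m b)" using m[of b g] by simp
  next
    fix x
    have "stationary {d. limit_point UNIV d \<and> m d = i x}" using i(2) by blast
    then show "stationary {d. limit_point UNIV d \<and> inv i (m d) = x}"
      by (rule stationary_mono) (use i(1) in auto)
  qed
  then show ?thesis by blast
qed

lemma labelled_system_coherent_label:
  fixes h :: "'k::wellorder \<Rightarrow> 't::wellorder"
  assumes "coherent_system C" "coherent_label C h" "\<And>i::'t. \<exists>j. i < j"
  shows "labelled_system C h"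
proof -
  interpret coherent_system "TYPE('k)" C by (rule assms(1))
  show ?thesis
  proof
    show "\<And>b g. limit_point (C b) g \<Longrightarrow> g < b \<Longrightarrow> h g = h b" using assms(2) by (auto simp: coherent_label_def)
    fix i :: 't
    obtain j where "i < j" using assms(3) by blast
    then have "{d. limit_point UNIV d \<and> h d = j} \<subseteq> {d. limit_point UNIV d \<and> i < h d}" by blast
    moreover have "stationary {d. limit_point UNIV d \<and> h d = j}" using assms(2) by (simp add: coherent_label_def)
    ultimately show "stationary {d. limit_point UNIV d \<and> i < h d}" by (rule stationary_mono[rotated])
  qed
qed

theorem theorem4p5:
  assumes "infinite_regular_cardinal (order_of TYPE('t::wellorder))"
    and "infinite_regular_cardinal (order_of TYPE('k::wellorder))"
    and "order_of TYPE('t) <o order_of TYPE('k)"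
    and "square_principle TYPE('k)"
  shows "\<exists>(c :: 'k set \<Rightarrow> 'k \<times> 'k) (e :: 'k set \<Rightarrow> 't).
    subadditive e \<and>
    (\<forall>A :: 'k set. |A| =o order_of TYPE('k) \<longrightarrow>
      (\<exists>D. club_in UNIV D \<and>
        (\<forall>\<delta>\<in>D. \<forall>\<beta>\<ge>\<delta>. \<forall>(\<xi>0, \<xi>1)\<in>{..<\<delta>} \<times> {..<\<delta>}. \<forall>i.
          cofinal_in {..<\<delta>} {\<alpha>. \<alpha> < \<delta> \<and> \<alpha> \<in> A \<and> c {\<alpha>, \<beta>} = (\<xi>0, \<xi>1) \<and> e {\<alpha>, \<beta>} > i})))"
proof -
  note rt = assms(1) and rk = assms(2)
  have tk: "|UNIV :: 't set| <o order_of TYPE('k)"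
    using card_UNIV_ordIso[OF rt] assms(3) by (rule ordIso_ordLess_trans)
  have inft: "infinite (UNIV :: 't set)"
    using rt by (simp add: infinite_regular_cardinal_def order_of_Field)
  then have "|UNIV :: nat set| \<le>o |UNIV :: 't set|" using infinite_iff_card_of_nat by blast
  then have nk: "|UNIV :: nat set| <o order_of TYPE('k)" using tk by (rule ordLeq_ordLess_trans)
  have t_bounded: "\<exists>b. \<forall>x. f x < b" for f :: "'t \<Rightarrow> 'k" using regular_bound[OF rk tk, of f] by blast
  interpret regular_uncountable "TYPE('k)"
  proof
    show "\<exists>b. \<forall>n. f n < b" for f :: "nat \<Rightarrow> 'k" using regular_bound[OF rk nk, of f] by blast
    show "\<exists>b. \<forall>x\<le>a. f x < b" for f :: "'k \<Rightarrow> 'k" and a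
      using regular_bound[OF rk card_atMost[OF rk], of a f] by auto
  qed
  obtain C0 :: "'k \<Rightarrow> 'k set" where "square_sequence C0" using assms(4) by (auto simp: square_principle_def)
  from square_coherent_system[OF this] obtain C :: "'k \<Rightarrow> 'k set" and m :: "'k \<Rightarrow> 'k"
    where C: "coherent_system C" and mC: "\<forall>b g. limit_point (C b) g \<and> g < b \<longrightarrow> m g = m b"
      and Z: "unbounded {z. stationary {d. limit_point UNIV d \<and> m d = z}}" by blast
  have m: "\<And>b g. limit_point (C b) g \<Longrightarrow> g < b \<Longrightarrow> m g = m b" using mC by blast
  have kk: "|UNIV :: ('k \<times> 'k) set| \<le>o order_of TYPE('k)"
  proof -
    have "infinite (UNIV :: 'k set)" using rk by (simp add: infinite_regular_cardinal_def order_of_Field)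
    then have "|(UNIV :: 'k set) \<times> (UNIV :: 'k set)| =o |UNIV :: 'k set|" by (rule card_of_Times_same_infinite)
    from ordIso_imp_ordLeq[OF ordIso_transitive[OF this card_UNIV_ordIso[OF rk]]]
    show ?thesis by (simp only: UNIV_Times_UNIV)
  qed
  obtain hn :: "'k \<Rightarrow> nat" where hn: "coherent_label C hn"
    using ex_coherent_label[OF rk m Z ordLess_imp_ordLeq[OF nk]] by blast
  obtain ht :: "'k \<Rightarrow> 't" where ht: "coherent_label C ht"
    using ex_coherent_label[OF rk m Z ordLess_imp_ordLeq[OF tk]] by blast
  obtain hx :: "'k \<Rightarrow> 'k \<times> 'k" where hx: "coherent_label C hx"
    using ex_coherent_label[OF rk m Z kk] by blast
  have labt: "labelled_system C ht" using labelled_system_coherent_label[OF C ht no_max[OF rt]] .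
  have labn: "labelled_system C hn" by (rule labelled_system_coherent_label[OF C hn]) (rule exI, rule lessI)
  interpret T: labelled_system "TYPE('k)" C ht by (rule labt)
  interpret N: nat_labelled_system "TYPE('k)" C hn by (rule nat_labelled_system.intro[OF labn])
  \<comment> \<open>\<open>Min\<close> and \<open>Max\<close> recover the ordered pair from a
    two-element set.\<close>
  define e where "e S = T.e (Min S) (Max S)" for S
  define c where "c S = hx (T.walk (Min S) (Max S) ! N.trace_colour (Min S) (Max S))" for S
  have mm: "Min {a, b} = a" "Max {a, b} = b" if "a < b" for a b :: 'k using that by auto
  have ee: "e {a, b} = T.e a b" "c {a, b} = hx (T.walk a b ! N.trace_colour a b)" if "a < b" for a b
    using mm[OF that] by (simp_all add: e_def c_def)
  have sub: "subadditive e" unfolding subadditive_def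
  proof (intro allI impI, elim conjE)
    fix a b t :: 'k assume ab: "a < b" "b < t"
    then have at: "a < t" by simp
    show "e {a, t} \<le> max (e {a, b}) (e {b, t}) \<and> e {a, b} \<le> max (e {a, t}) (e {b, t})"
      unfolding ee(1)[OF ab(1)] ee(1)[OF ab(2)] ee(1)[OF at] using T.subadd ab by simp
  qed
  have main: "\<exists>D. club_in UNIV D \<and>
        (\<forall>\<delta>\<in>D. \<forall>\<beta>\<ge>\<delta>. \<forall>(\<xi>0, \<xi>1)\<in>{..<\<delta>} \<times> {..<\<delta>}. \<forall>i.
          cofinal_in {..<\<delta>} {\<alpha>. \<alpha> < \<delta> \<and> \<alpha> \<in> A \<and> c {\<alpha>, \<beta>} = (\<xi>0, \<xi>1) \<and> e {\<alpha>, \<beta>} > i})"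
    if "|A| =o order_of TYPE('k)" for A :: "'k set"
  proof -
    have A: "unbounded A" using unbounded_of_card[OF rk that] .
    define P where "P \<gamma> \<xi> i \<delta> \<longleftrightarrow>
        (\<forall>\<beta>\<ge>\<delta>. \<exists>\<alpha>\<in>{a\<in>A. \<gamma> < a}. \<alpha> < \<delta> \<and> hx (T.walk \<alpha> \<beta> ! N.trace_colour \<alpha> \<beta>) = \<xi> \<and> i < T.e \<alpha> \<beta>)"
      for \<gamma> \<xi> i \<delta>
    have "\<exists>\<delta>. P \<gamma> \<xi> i \<delta>" for \<gamma> \<xi> i
      unfolding P_def by (rule N.simultaneous_hit[OF labt hx N.unbounded_greater[OF A]])
    then obtain f where f: "\<And>\<gamma> \<xi> i. P \<gamma> \<xi> i (f \<gamma> \<xi> i)" by metis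
    \<comment> \<open>The parameters are bounded away one at a time: \<open>i\<close> because
      \<theta> < \<kappa>, then \<open>\<xi>1\<close>, \<open>\<xi>0\<close> and
      \<open>\<gamma>\<close> up to \<open>x\<close> by regularity. The closure points of the
      resulting \<open>f4\<close> form the club, and the restriction to \<open>\<gamma> < a\<close>
      yields cofinality.\<close>
    have "\<exists>B. \<forall>i. f \<gamma> (\<xi>0, \<xi>1) i < B" for \<gamma> \<xi>0 \<xi>1 by (rule t_bounded)
    then obtain f1 where f1: "\<And>\<gamma> \<xi>0 \<xi>1 i. f \<gamma> (\<xi>0, \<xi>1) i < f1 \<gamma> \<xi>0 \<xi>1" by metis
    have "\<exists>B. \<forall>\<xi>1\<le>x. f1 \<gamma> \<xi>0 \<xi>1 < B" for x \<gamma> \<xi>0 by (rule segment_bounded)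
    then obtain f2 where f2: "\<And>x \<gamma> \<xi>0 \<xi>1. \<xi>1 \<le> x \<Longrightarrow> f1 \<gamma> \<xi>0 \<xi>1 < f2 x \<gamma> \<xi>0" by metis
    have "\<exists>B. \<forall>\<xi>0\<le>x. f2 x \<gamma> \<xi>0 < B" for x \<gamma> by (rule segment_bounded)
    then obtain f3 where f3: "\<And>x \<gamma> \<xi>0. \<xi>0 \<le> x \<Longrightarrow> f2 x \<gamma> \<xi>0 < f3 x \<gamma>" by metis
    have "\<exists>B. \<forall>\<gamma>\<le>x. f3 x \<gamma> < B" for x by (rule segment_bounded)
    then obtain f4 where f4: "\<And>x \<gamma>. \<gamma> \<le> x \<Longrightarrow> f3 x \<gamma> < f4 x" by metis
    let ?D = "{d. \<forall>g<d. f4 g < d}"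
    have D: "club_in UNIV ?D" using club_in_UNIV_iff[of ?D, OF ex_gt] club_closure[of f4] by simp
    have cof: "cofinal_in {..<\<delta>} {\<alpha>. \<alpha> < \<delta> \<and> \<alpha> \<in> A \<and> c {\<alpha>, \<beta>} = (\<xi>0, \<xi>1) \<and> e {\<alpha>, \<beta>} > i}"
      if \<delta>: "\<delta> \<in> ?D" and \<beta>: "\<delta> \<le> \<beta>" and \<xi>: "\<xi>0 < \<delta>" "\<xi>1 < \<delta>" for \<delta> \<beta> \<xi>0 \<xi>1 i
      unfolding cofinal_in_def
    proof (intro conjI ballI)
      fix \<gamma> assume "\<gamma> \<in> {..<\<delta>}"
      define x where "x = max \<gamma> (max \<xi>0 \<xi>1)"
      have x: "\<gamma> \<le> x" "\<xi>0 \<le> x" "\<xi>1 \<le> x" "x < \<delta>" using \<xi> \<open>\<gamma> \<in> {..<\<delta>}\<close> by (simp_all add: x_def le_max_iff_disj)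
      have "f \<gamma> (\<xi>0, \<xi>1) i < f1 \<gamma> \<xi>0 \<xi>1" by (rule f1)
      also have "\<dots> < f2 x \<gamma> \<xi>0" by (rule f2[OF x(3)])
      also have "\<dots> < f3 x \<gamma>" by (rule f3[OF x(2)])
      also have "\<dots> < f4 x" by (rule f4[OF x(1)])
      also have "\<dots> < \<delta>" using \<delta> x(4) by simp
      finally have lt: "f \<gamma> (\<xi>0, \<xi>1) i < \<delta>" .
      then have "f \<gamma> (\<xi>0, \<xi>1) i \<le> \<beta>" using \<beta> by simp
      with f[of \<gamma> "(\<xi>0, \<xi>1)" i] obtain \<alpha> where \<alpha>: "\<alpha> \<in> A" "\<gamma> < \<alpha>" "\<alpha> < f \<gamma> (\<xi>0, \<xi>1) i"
        "hx (T.walk \<alpha> \<beta> ! N.trace_colour \<alpha> \<beta>) = (\<xi>0, \<xi>1)" "i < T.e \<alpha> \<beta>"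
        unfolding P_def by blast
      then have "\<alpha> < \<delta>" using lt by simp
      then have "\<alpha> < \<beta>" using \<beta> by simp
      have "c {\<alpha>, \<beta>} = (\<xi>0, \<xi>1)" "e {\<alpha>, \<beta>} > i"
        unfolding ee[OF \<open>\<alpha> < \<beta>\<close>] by (rule \<alpha>(4), rule \<alpha>(5))
      with \<alpha>(1,2) \<open>\<alpha> < \<delta>\<close>
      show "\<exists>\<alpha>\<in>{\<alpha>. \<alpha> < \<delta> \<and> \<alpha> \<in> A \<and> c {\<alpha>, \<beta>} = (\<xi>0, \<xi>1) \<and> e {\<alpha>, \<beta>} > i}. \<gamma> \<le> \<alpha>"
        by (intro bexI[of _ \<alpha>] CollectI conjI less_imp_le)
    next
      show "{\<alpha>. \<alpha> < \<delta> \<and> \<alpha> \<in> A \<and> c {\<alpha>, \<beta>} = (\<xi>0, \<xi>1) \<and> e {\<alpha>, \<beta>} > i} \<subseteq> {..<\<delta>}" by blast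
    qed
    show ?thesis
    proof (intro exI conjI ballI allI impI)
      show "club_in UNIV ?D" by (rule D)
      fix \<delta> \<beta> \<xi> assume "\<delta> \<in> ?D" "\<delta> \<le> \<beta>" "\<xi> \<in> {..<\<delta>} \<times> {..<\<delta>}"
      then show "case \<xi> of (\<xi>0, \<xi>1) \<Rightarrow> \<forall>i.
          cofinal_in {..<\<delta>} {\<alpha>. \<alpha> < \<delta> \<and> \<alpha> \<in> A \<and> c {\<alpha>, \<beta>} = (\<xi>0, \<xi>1) \<and> e {\<alpha>, \<beta>} > i}"
        using cof[of \<delta> \<beta> "fst \<xi>" "snd \<xi>"] by (simp add: case_prod_unfold mem_Times_iff)
    qed
  qed
  show ?thesis by (intro exI[of _ c] exI[of _ e] conjI allI impI sub main)
qed

end
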